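(* Let $q\ge2$ be an integer, let $T_{q+1}$ be the homogeneous tree in which every vertex has exactly $q+1$ neighbours, with a fixed root at infinity, and let $m(x)=q^{\ell(x)}$ be the canonical flow measure on $T_{q+1}$. Let $a,b,c,d\in\mathbb R$ with $c>1$, set $\sigma_j(x)=q^{(j-1)\ell(x)}$ for $j\in\{a,b,c,d\}$, and let $p\in[1,\infty)$. The following are equivalent: i') $\mathcal U_{a,b,c}$ is bounded on $L^p(m\cdot\sigma_d)$; ii') $\mathcal V_{a,b,c}$ is bounded on $L^p(m\cdot\sigma_d)$; iii') $-a<\frac{d-1}{p}<b-1$ and $c=a+b$.
   Context: Tree notation. Write $T=T_{q+1}$, with graph distance $\mathrm{dist}$ and a fixed reference vertex $o$. The boundary $\partial T$ is the set of equivalence classes of infinite geodesics starting at $o$ (two being equivalent if they eventually coincide). Fix $\omega\in\partial T$ (the root at infinity); let $[o,\omega)=\{x_n\}_{n\ge0}$ be the geodesic ray from $o$ (with $x_0=o$) representing $\omega$. The level is $\ell(x)=\lim_{n\to\infty}(n-\mathrm{dist}(x,x_n))$. For each vertex $x$, $p(x)$ is the unique neighbour with $\ell(p(x))=\ell(x)+1$, and $s(x)$ is the set of the other $q$ neighbours (successors). $p^0(x)=x$, $p^n(x)=p(p^{n-1}(x))$; $s_0(x)=\{x\}$, $s_n(x)=\bigcup_{y\in s_{n-1}(x)}s(y)$. $T_x=\bigcup_{n\ge0}s_n(x)$ and $\dot T_x=T_x\setminus\{x\}$. $m\cdot\sigma_j$ is the measure on $T$ giving mass $m(x)\sigma_j(x)$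 to the vertex $x$. The weight $\sigma_c$ is also regarded as the function $n\mapsto q^{(c-1)n}$ on $\mathbb Z$. For $n\in\mathbb Z$, $x\in T$, set $S_{n,x}(\sigma_c)=\sum_{k=0}^\infty\sigma_c(\ell(x)+n-k)$. For $v,z,x\in T$ set $\Psi(v,z,x)=0$ if $\{x,z\}\not\subset\dot T_v$; $\Psi(v,z,x)=\frac1{m(y)}-\frac1{m(v)}$ if $\{x,z\}\subset T_y$ for some $y\in s(v)$; and $\Psi(v,z,x)=-\frac1{m(v)}$ otherwise. The Bergman kernel of $L^2(m\cdot\sigma_c)$ is $$K_c(x,y)=\sum_{n=0}^\infty\frac{\Psi(p^{n+1}(x),p^n(x),y)}{S_{n,x}(\sigma_c)},\qquad x,y\in T.$$ The operators are $$\mathcal U_{a,b,c}f(x)=m(x)\sigma_a(x)\sum_{y\in T}K_c(x,y)f(y)m(y)\sigma_b(y),$$ $$\mathcal V_{a,b,c}f(x)=m(x)\sigma_a(x)\sum_{y\in T}|K_c(x,y)|f(y)m(y)\sigma_b(y).$$ Such an operator is bounded on $L^p(m\cdot\sigma_d)$ if there is a constant $C$ such that for every $f\in L^p(m\cdot\sigma_d)$ the series converges absolutely for every $x$ and the $L^p(m\cdot\sigma_d)$-norm of its image is at most $C\|f\|_{L^p(m\cdot\sigma_d)}$. *)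

theory Defs
  imports "HOL-Analysis.Analysis"
begin

section \<open>Trees and their boundary\<close>

text \<open>A simple graph is given by its adjacency relation; the vertex set is the whole type.\<close>

definition has_cycle :: "('v \<Rightarrow> 'v \<Rightarrow> bool) \<Rightarrow> bool" where
  "has_cycle E \<longleftrightarrow>
     (\<exists>xs. length xs \<ge> 3 \<and> distinct xs \<and> successively E xs \<and> E (last xs) (hd xs))"

definition is_tree :: "('v \<Rightarrow> 'v \<Rightarrow> bool) \<Rightarrow> bool" where
  "is_tree E \<longleftrightarrow> symp E \<and> irreflp E \<and> (\<forall>x y. E\<^sup>*\<^sup>* x y) \<and> \<not> has_cycle E"

definition graph_dist :: "('v \<Rightarrow> 'v \<Rightarrow> bool) \<Rightarrow> 'v \<Rightarrow> 'v \<Rightarrow> nat" where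
  "graph_dist E x y = (LEAST n. (E ^^ n) x y)"

definition geodesic_rays :: "('v \<Rightarrow> 'v \<Rightarrow> bool) \<Rightarrow> 'v \<Rightarrow> (nat \<Rightarrow> 'v) set" where
  "geodesic_rays E v =
     {r. r 0 = v \<and> (\<forall>i j. int (graph_dist E (r i) (r j)) = \<bar>int i - int j\<bar>)}"

text \<open>Since all rays issue from the same vertex, they can only coincide eventually with the
  same parametrisation.\<close>

definition tree_boundary :: "('v \<Rightarrow> 'v \<Rightarrow> bool) \<Rightarrow> 'v \<Rightarrow> (nat \<Rightarrow> 'v) set set" where
  "tree_boundary E v =
     geodesic_rays E v //
       {(r, s). r \<in> geodesic_rays E v \<and> s \<in> geodesic_rays E v \<and>
                (\<forall>\<^sub>F n in sequentially. r n = s n)}"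


section \<open>Lebesgue spaces\<close>

text \<open>Functions are not identified when they agree almost everywhere; the measures used below
  charge every vertex.\<close>

definition Lp_space :: "real \<Rightarrow> 'v measure \<Rightarrow> ('v \<Rightarrow> complex) set" where
  "Lp_space p M = {f \<in> borel_measurable M. integrable M (\<lambda>x. norm (f x) powr p)}"

definition Lp_norm :: "real \<Rightarrow> 'v measure \<Rightarrow> ('v \<Rightarrow> complex) \<Rightarrow> real" where
  "Lp_norm p M f = (\<integral>x. norm (f x) powr p \<partial>M) powr (1 / p)"

text \<open>Here \<open>A\<close> is an operator whose value \<open>A f x\<close> is defined through the series with terms
  \<open>t f x y\<close>, indexed by \<open>y\<close>.\<close>

definition bounded_on_Lp ::
  "real \<Rightarrow> 'v measure \<Rightarrow> (('v \<Rightarrow> complex) \<Rightarrow> 'v \<Rightarrow> 'v \<Rightarrow> complex) \<Rightarrow>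
   (('v \<Rightarrow> complex) \<Rightarrow> 'v \<Rightarrow> complex) \<Rightarrow> bool" where
  "bounded_on_Lp p M t A \<longleftrightarrow>
     (\<exists>C. \<forall>f \<in> Lp_space p M.
        (\<forall>x. (\<lambda>y. norm (t f x y)) summable_on UNIV) \<and>
        A f \<in> Lp_space p M \<and> Lp_norm p M (A f) \<le> C * Lp_norm p M f)"


section \<open>The homogeneous tree with root at infinity\<close>

locale homogeneous_flow_tree =
  fixes q :: nat
    and E :: "'v \<Rightarrow> 'v \<Rightarrow> bool"
    and ref :: 'v
    and \<omega> :: "(nat \<Rightarrow> 'v) set"
  assumes q_ge_2: "q \<ge> 2"
    and tree: "is_tree E"
    and regular: "\<And>x. card {y. E x y} = q + 1"
    and root_at_infinity: "\<omega> \<in> tree_boundary E ref"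
begin

text \<open>The class \<open>\<omega>\<close> contains exactly one ray, because distinct geodesics from the
  same vertex of a tree never meet again after separating.\<close>

definition root_ray :: "nat \<Rightarrow> 'v" where
  "root_ray = (THE r. r \<in> \<omega>)"

definition level :: "'v \<Rightarrow> int" where
  "level x = lim (\<lambda>n. int n - int (graph_dist E x (root_ray n)))"

definition parent :: "'v \<Rightarrow> 'v" where
  "parent x = (THE y. E x y \<and> level y = level x + 1)"

definition succs :: "'v \<Rightarrow> 'v set" where
  "succs x = {y. E x y \<and> y \<noteq> parent x}"

primrec succs_iter :: "nat \<Rightarrow> 'v \<Rightarrow> 'v set" where
  "succs_iter 0 x = {x}"
| "succs_iter (Suc n) x = (\<Union>y \<in> succs_iter n x. succs y)"

definition sector :: "'v \<Rightarrow> 'v set" where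
  "sector x = (\<Union>n. succs_iter n x)"

definition open_sector :: "'v \<Rightarrow> 'v set" where
  "open_sector x = sector x - {x}"

definition m :: "'v \<Rightarrow> real" where
  "m x = real q powi level x"

definition \<sigma> :: "real \<Rightarrow> int \<Rightarrow> real" where
  "\<sigma> j n = real q powr ((j - 1) * real_of_int n)"

definition weighted_measure :: "real \<Rightarrow> 'v measure" where
  "weighted_measure j = point_measure UNIV (\<lambda>x. ennreal (m x * \<sigma> j (level x)))"

definition S :: "int \<Rightarrow> 'v \<Rightarrow> real \<Rightarrow> real" where
  "S n x c = (\<Sum>k. \<sigma> c (level x + n - int k))"

text \<open>The successor \<open>y\<close> in the second case is unique, since the sectors of distinct
  successors of \<open>v\<close> are disjoint.\<close>

definition \<Psi> :: "'v \<Rightarrow> 'v \<Rightarrow> 'v \<Rightarrow> real" where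
  "\<Psi> v z x =
     (if \<not> {x, z} \<subseteq> open_sector v then 0
      else if \<exists>y \<in> succs v. {x, z} \<subseteq> sector y
        then 1 / m (THE y. y \<in> succs v \<and> {x, z} \<subseteq> sector y) - 1 / m v
      else - 1 / m v)"

definition bergman_kernel :: "real \<Rightarrow> 'v \<Rightarrow> 'v \<Rightarrow> real" where
  "bergman_kernel c x y =
     (\<Sum>n. \<Psi> ((parent ^^ Suc n) x) ((parent ^^ n) x) y / S (int n) x c)"

definition U_term :: "real \<Rightarrow> real \<Rightarrow> ('v \<Rightarrow> complex) \<Rightarrow> 'v \<Rightarrow> 'v \<Rightarrow> complex" where
  "U_term b c f x y =
     of_real (bergman_kernel c x y) * f y * of_real (m y) * of_real (\<sigma> b (level y))"

definition U :: "real \<Rightarrow> real \<Rightarrow> real \<Rightarrow> ('v \<Rightarrow> complex) \<Rightarrow> 'v \<Rightarrow> complex" where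
  "U a b c f x = of_real (m x * \<sigma> a (level x)) * (\<Sum>\<^sub>\<infinity>y. U_term b c f x y)"

definition V_term :: "real \<Rightarrow> real \<Rightarrow> ('v \<Rightarrow> complex) \<Rightarrow> 'v \<Rightarrow> 'v \<Rightarrow> complex" where
  "V_term b c f x y =
     of_real \<bar>bergman_kernel c x y\<bar> * f y * of_real (m y) * of_real (\<sigma> b (level y))"

definition V :: "real \<Rightarrow> real \<Rightarrow> real \<Rightarrow> ('v \<Rightarrow> complex) \<Rightarrow> 'v \<Rightarrow> complex" where
  "V a b c f x = of_real (m x * \<sigma> a (level x)) * (\<Sum>\<^sub>\<infinity>y. V_term b c f x y)"

definition U_bounded :: "real \<Rightarrow> real \<Rightarrow> real \<Rightarrow> real \<Rightarrow> real \<Rightarrow> bool" where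
  "U_bounded a b c p d \<longleftrightarrow> bounded_on_Lp p (weighted_measure d) (U_term b c) (U a b c)"

definition V_bounded :: "real \<Rightarrow> real \<Rightarrow> real \<Rightarrow> real \<Rightarrow> real \<Rightarrow> bool" where
  "V_bounded a b c p d \<longleftrightarrow> bounded_on_Lp p (weighted_measure d) (V_term b c) (V a b c)"

end

end

theory Submission
  imports Defs
begin

text \<open>
  Let \<open>L\<close> be the level of the lowest common ancestor of \<open>x\<close> and \<open>y\<close>. From that ancestor upwards the
  series for \<open>K\<^sub>c(x, y)\<close> is geometric: up to a constant factor, the term that belongs to an ancestor \<open>z\<close>
  of \<open>x\<close> is \<open>q powr (-c * level z)\<close>. One exceptional term precedes this geometric series when \<open>x\<close> and \<open>y\<close>
  are incomparable, that is, when they are distinct and neither is an ancestor of the other. Hence (\<open>bergman_kernel_eq\<close>) the kernel is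
  \<open>q powr (-c * L)\<close> times a constant that takes one positive value on comparable pairs and another
  value on incomparable pairs. The proof uses only two consequences: the identity
  \<open>K = A * q powr (-c * L)\<close> with \<open>A > 0\<close> on comparable pairs, and the bound
  \<open>\<bar>K\<bar> \<le> B * q powr (-c * L)\<close> everywhere. They hold for \<open>K\<close> and for \<open>\<bar>K\<bar>\<close> alike, so both operators
  are instances of one statement, \<open>kernel_op_bounded_iff\<close>.

  Sufficiency. Let \<open>n\<close> and \<open>k\<close> be the numbers of steps from \<open>x\<close> and from \<open>y\<close> up to the common ancestor.
  If \<open>c = a + b\<close>, the weighted kernel is at most \<open>B * q powr (-a n - b k)\<close>. For given \<open>(n, k)\<close> each \<open>x\<close>
  meets at most \<open>q ^ k\<close> vertices \<open>y\<close> and each \<open>y\<close> meets at most \<open>q ^ n\<close> vertices \<open>x\<close>, and Jensen's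
  inequality shows that this block of the operator has norm at most \<open>B * q powr (s n + t k)\<close> with
  \<open>s = - a - (d - 1) / p\<close> and \<open>t = (d - 1) / p - (b - 1)\<close>. The two inequalities of the theorem say that
  \<open>s\<close> and \<open>t\<close> are negative, that is, that the block norms are summable. The summation over blocks is done
  in one stroke by a Schur test (\<open>Schur_test\<close>, \<open>sum_climb_le\<close>, \<open>kernel_op_bounded\<close>).

  Necessity (\<open>kernel_op_bounded_necessary\<close>). Finitely supported functions are tested on comparable pairs.
  A point mass at \<open>x\<close>, evaluated at \<open>x\<close>, forces \<open>q powr ((a + b - c) * level x)\<close> to be bounded over all
  levels, so \<open>c = a + b\<close>. A point mass evaluated on all its descendants yields a geometric series that
  converges only if \<open>s < 0\<close>. For \<open>t < 0\<close>, if \<open>p = 1\<close> a point mass is evaluated on its ancestors, and if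
  \<open>p > 1\<close> a radial function on \<open>N\<close> generations below a vertex \<open>r\<close> of level \<open>0\<close> is evaluated at \<open>r\<close>: were
  \<open>t \<ge> 0\<close>, its norm would be at most \<open>N powr (1 / p)\<close> while its image at \<open>r\<close> has size \<open>A * N\<close>.
\<close>

section \<open>Distances in trees\<close>

lemma relpowp_graph_dist:
  assumes "\<forall>x y. E\<^sup>*\<^sup>* x y"
  shows "(E ^^ graph_dist E x y) x y"
  unfolding graph_dist_def
  using assms rtranclp_imp_relpowp[of E x y] by (metis LeastI)

lemma graph_dist_le: "(E ^^ n) x y \<Longrightarrow> graph_dist E x y \<le> n"
  unfolding graph_dist_def by (rule Least_le)

lemma graph_dist_triangle:
  assumes "\<forall>x y. E\<^sup>*\<^sup>* x y"
  shows "graph_dist E x z \<le> graph_dist E x y + graph_dist E y z"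
  by (rule graph_dist_le)
     (use relpowp_graph_dist[OF assms] in \<open>auto simp: relpowp_add\<close>)

lemma graph_dist_edge_le: "E x y \<Longrightarrow> graph_dist E x y \<le> 1"
  by (rule graph_dist_le) (simp add: eq_OO)

lemma graph_dist_eq_0: "(\<forall>x y. E\<^sup>*\<^sup>* x y) \<Longrightarrow> graph_dist E x y = 0 \<Longrightarrow> x = y"
  using relpowp_graph_dist[of E x y] by simp

lemma closer_neighbour_exists:
  assumes "\<forall>x y. E\<^sup>*\<^sup>* x y" "x \<noteq> v"
  obtains z where "E x z" "graph_dist E x v = Suc (graph_dist E z v)"
proof -
  have "graph_dist E x v \<noteq> 0"
    using graph_dist_eq_0[OF assms(1)] assms(2) by blast
  then obtain k where k: "graph_dist E x v = Suc k"
    by (cases "graph_dist E x v") auto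
  then obtain z where z: "E x z" "(E ^^ k) z v"
    using relpowp_graph_dist[OF assms(1), of x v] by (metis relpowp_Suc_D2)
  have "graph_dist E z v \<le> k" using z(2) by (rule graph_dist_le)
  moreover have "graph_dist E x v \<le> 1 + graph_dist E z v"
    using graph_dist_triangle[OF assms(1), of x v z] graph_dist_edge_le[of E x z] z(1) by linarith
  ultimately show thesis using that z(1) k by simp
qed

lemma rtranclp_distinct_path:
  assumes "R\<^sup>*\<^sup>* y z"
  shows "\<exists>xs. xs \<noteq> [] \<and> hd xs = y \<and> last xs = z \<and> distinct xs \<and> successively R xs"
  using assms
proof (induction rule: rtranclp_induct)
  case base
  have "[y] \<noteq> [] \<and> hd [y] = y \<and> last [y] = y \<and> distinct [y] \<and> successively R [y]" by simp
  then show ?case by blast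
next
  case (step u w)
  then obtain xs where xs: "xs \<noteq> []" "hd xs = y" "last xs = u" "distinct xs" "successively R xs"
    by blast
  show ?case
  proof (cases "w \<in> set xs")
    case True
    then obtain ys zs where "xs = ys @ w # zs" by (meson split_list)
    with xs have "ys @ [w] \<noteq> [] \<and> hd (ys @ [w]) = y \<and> last (ys @ [w]) = w
        \<and> distinct (ys @ [w]) \<and> successively R (ys @ [w])"
      by (auto simp: successively_append_iff hd_append split: if_splits)
    then show ?thesis by blast
  next
    case False
    with xs step have "xs @ [w] \<noteq> [] \<and> hd (xs @ [w]) = y \<and> last (xs @ [w]) = w
        \<and> distinct (xs @ [w]) \<and> successively R (xs @ [w])"
      by (auto simp: successively_append_iff)
    then show ?thesis by blast
  qed
qed

text \<open>
  A path between two distinct neighbours of \<open>x\<close> that avoids \<open>x\<close> can be shortened to one without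
  repetitions, and \<open>x\<close> then closes it up to a cycle.
\<close>

lemma tree_neighbours_separated:
  assumes "is_tree E" and y: "E x y" and y': "E x y'"
    and path: "(\<lambda>u w. E u w \<and> u \<noteq> x \<and> w \<noteq> x)\<^sup>*\<^sup>* y y'"
  shows "y = y'"
proof (rule ccontr)
  assume "y \<noteq> y'"
  have tree: "symp E" "irreflp E" "\<not> has_cycle E" using assms(1) by (auto simp: is_tree_def)
  obtain xs where xs: "xs \<noteq> []" "hd xs = y" "last xs = y'" "distinct xs"
      "successively (\<lambda>u w. E u w \<and> u \<noteq> x \<and> w \<noteq> x) xs"
    using rtranclp_distinct_path[OF path] by blast
  obtain t ts where ts: "xs = y # t # ts"
    using xs(1-3) \<open>y \<noteq> y'\<close> by (metis last.simps list.collapse)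
  have succ: "successively E xs" using xs(5) by (rule successively_mono) auto
  have avoid: "x \<notin> set zs" if "successively (\<lambda>u w. E u w \<and> u \<noteq> x \<and> w \<noteq> x) zs" "length zs \<ge> 2" for zs
    using that
  proof (induction zs)
    case (Cons a zs)
    then show ?case
      by (cases zs; cases "tl zs") (auto simp: successively_Cons)
  qed simp
  have "x \<notin> set xs" using avoid[OF xs(5)] ts by simp
  then have "length (x # xs) \<ge> 3 \<and> distinct (x # xs) \<and> successively E (x # xs)
      \<and> E (last (x # xs)) (hd (x # xs))"
    using xs ts succ y y' tree(1) by (auto simp: successively_Cons dest: sympD)
  then show False using tree(3) unfolding has_cycle_def by blast
qed

text \<open>
  Along a geodesic from a neighbour \<open>y\<close> to \<open>v\<close> the distance to \<open>v\<close> decreases, so it never returns to \<open>x\<close>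
  if \<open>y\<close> is at most as far from \<open>v\<close> as \<open>x\<close>. Two such neighbours are thus joined by a path avoiding \<open>x\<close>.
  The non-strict bounds matter: they also exclude neighbours at the same distance from \<open>v\<close> as \<open>x\<close>.
\<close>

lemma tree_closer_neighbour_unique:
  assumes tree: "is_tree E" and y: "E x y" and y': "E x y'"
    and "graph_dist E y v \<le> graph_dist E x v" "graph_dist E y' v \<le> graph_dist E x v"
  shows "y = y'"
proof -
  have conn: "\<forall>x y. E\<^sup>*\<^sup>* x y" and sym: "symp E" and irr: "irreflp E"
    using tree by (auto simp: is_tree_def)
  let ?R = "\<lambda>u w. E u w \<and> u \<noteq> x \<and> w \<noteq> x"
  have to_v: "?R\<^sup>*\<^sup>* u v" if "u \<noteq> x" "graph_dist E u v \<le> graph_dist E x v" for u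
    using that
  proof (induction "graph_dist E u v" arbitrary: u rule: less_induct)
    case less
    show ?case
    proof (cases "u = v")
      case False
      then obtain z where z: "E u z" "graph_dist E u v = Suc (graph_dist E z v)"
        using closer_neighbour_exists[OF conn] by blast
      then have "z \<noteq> x" using less.prems by auto
      moreover from this have "?R\<^sup>*\<^sup>* z v" using less z by auto
      ultimately show ?thesis using z(1) less.prems(1)
        by (metis (mono_tags, lifting) converse_rtranclp_into_rtranclp)
    qed simp
  qed
  have "symp ?R" using sym by (auto simp: symp_def)
  then have symR: "symp ?R\<^sup>*\<^sup>*" by (rule symp_rtranclp)
  have "y \<noteq> x" "y' \<noteq> x" using y y' irr by (auto simp: irreflp_def)
  then have "?R\<^sup>*\<^sup>* y v" "?R\<^sup>*\<^sup>* y' v" using to_v assms(4,5) by auto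
  then have "?R\<^sup>*\<^sup>* y y'" using symR by (meson rtranclp_trans sympD)
  then show ?thesis by (rule tree_neighbours_separated[OF tree y y'])
qed

lemma geodesic_rays_dist:
  assumes "r \<in> geodesic_rays E v" "i \<le> j"
  shows "graph_dist E (r i) (r j) = j - i"
proof -
  have "int (graph_dist E (r i) (r j)) = \<bar>int i - int j\<bar>"
    using assms(1) unfolding geodesic_rays_def by blast
  then show ?thesis using assms(2) by linarith
qed

section \<open>Levels, parents and descendants\<close>

context homogeneous_flow_tree
begin

lemma connected: "\<forall>x y. E\<^sup>*\<^sup>* x y" and E_sym: "E x y \<Longrightarrow> E y x"
  using tree by (auto simp: is_tree_def dest: sympD)

text \<open>
  Both rays reach the same vertex \<open>r N\<close>. As long as they agree, their next vertices are neighbours of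
  a common vertex that are closer to \<open>r N\<close>, hence equal.
\<close>

lemma geodesic_rays_eventually_equal:
  assumes r: "r \<in> geodesic_rays E v" and s: "s \<in> geodesic_rays E v"
    and ev: "\<forall>\<^sub>F n in sequentially. r n = s n"
  shows "r = s"
proof
  fix i
  note dist_r = geodesic_rays_dist[OF r] and dist_s = geodesic_rays_dist[OF s]
  have edge_r: "E (r i) (r (Suc i))" for i
    using relpowp_graph_dist[OF connected, of "r i" "r (Suc i)"] dist_r[of i "Suc i"] by (simp add: eq_OO)
  have edge_s: "E (s i) (s (Suc i))" for i
    using relpowp_graph_dist[OF connected, of "s i" "s (Suc i)"] dist_s[of i "Suc i"] by (simp add: eq_OO)
  from ev obtain M where "\<forall>n\<ge>M. r n = s n" by (auto simp: eventually_sequentially)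
  then obtain N where N: "N \<ge> i" "r N = s N" by (metis linear)
  have "r j = s j" if "j \<le> N" for j
    using that
  proof (induction j)
    case 0
    then show ?case using r s by (simp add: geodesic_rays_def)
  next
    case (Suc j)
    then show ?case
      using tree_closer_neighbour_unique[OF tree, of "r j" "r (Suc j)" "s (Suc j)" "r N"]
        edge_r[of j] edge_s[of j] dist_r[of j N] dist_r[of "Suc j" N] dist_s[of "Suc j" N] N(2)
      by simp
  qed
  then show "r i = s i" using N(1) by simp
qed

lemma root_ray_geodesic: "root_ray \<in> geodesic_rays E ref"
proof -
  obtain r where r: "r \<in> geodesic_rays E ref"
    "\<omega> = {(r, s). r \<in> geodesic_rays E ref \<and> s \<in> geodesic_rays E ref \<and>
                (\<forall>\<^sub>F n in sequentially. r n = s n)} `` {r}"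
    using root_at_infinity unfolding tree_boundary_def by (elim quotientE)
  then have "\<omega> = {r}" using geodesic_rays_eventually_equal by auto
  then have "root_ray = r" unfolding root_ray_def by simp
  then show ?thesis using r(1) by simp
qed

lemma root_ray_dist: "graph_dist E (root_ray i) (root_ray (i + k)) = k"
  using geodesic_rays_dist[OF root_ray_geodesic, of i "i + k"] by simp

text \<open>
  By the triangle inequality the sequence defining the level is nondecreasing and bounded. Since its
  terms are integers, it is eventually equal to its maximum.
\<close>

lemma
  shows level_ge: "int n - int (graph_dist E x (root_ray n)) \<le> level x"
    and level_eventually:
      "\<forall>\<^sub>F n in sequentially. int n - int (graph_dist E x (root_ray n)) = level x"
proof -
  let ?u = "\<lambda>n. int n - int (graph_dist E x (root_ray n))"
  have mono: "incseq ?u"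
  proof (rule incseq_SucI)
    fix n
    show "?u n \<le> ?u (Suc n)"
      using graph_dist_triangle[OF connected, of x "root_ray (Suc n)" "root_ray n"]
        root_ray_dist[of n 1] by simp
  qed
  have bound: "?u n \<le> int (graph_dist E (root_ray 0) x)" for n
    using graph_dist_triangle[OF connected, of "root_ray 0" "root_ray n" x]
      root_ray_dist[of 0 n] by simp
  \<comment> \<open>Integer-valued, monotone and bounded: the range lies in a finite interval.\<close>
  have "finite (?u ` UNIV)"
  proof (rule finite_subset)
    show "range ?u \<subseteq> {?u 0..int (graph_dist E (root_ray 0) x)}"
      using bound monoD[OF mono le0] by fastforce
  qed simp
  then have max: "Max (range ?u) \<in> range ?u" "\<And>n. ?u n \<le> Max (range ?u)"
    by (auto intro: Max_in)
  then obtain N where N: "?u N = Max (range ?u)" by (metis (no_types, lifting) imageE)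
  have const: "?u n = Max (range ?u)" if "n \<ge> N" for n
    using monoD[OF mono that] max(2)[of n] N by linarith
  then have ev: "\<forall>\<^sub>F n in sequentially. ?u n = Max (range ?u)"
    by (auto simp: eventually_sequentially)
  then have "?u \<longlonglongrightarrow> Max (range ?u)" by (rule tendsto_eventually)
  then have "level x = Max (range ?u)" unfolding level_def by (rule limI)
  then show "?u n \<le> level x" "\<forall>\<^sub>F n in sequentially. ?u n = level x"
    using max(2) ev by auto
qed

lemma level_edge_le: "E x y \<Longrightarrow> level y \<le> level x + 1"
proof -
  assume e: "E x y"
  have "\<forall>\<^sub>F n in sequentially. level y \<le> level x + 1"
    using level_eventually[of y]
  proof eventually_elim
    case (elim n)
    then show ?case
      using level_ge[of n x] graph_dist_triangle[OF connected, of x "root_ray n" y]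
        graph_dist_edge_le[of E x y] e by linarith
  qed
  then show ?thesis by simp
qed

text \<open>
  Seen from a far vertex of the root ray, a neighbour whose level is not smaller than that of \<open>x\<close> is
  not farther away than \<open>x\<close>, and there is only one such neighbour. Consequently no edge joins two
  vertices of the same level.
\<close>

lemma rising_neighbour_unique:
  assumes "E x y" "E x y'" "level x \<le> level y" "level x \<le> level y'"
  shows "y = y'"
proof -
  have "\<forall>\<^sub>F n in sequentially. y = y'"
    using level_eventually[of x] level_eventually[of y] level_eventually[of y']
  proof eventually_elim
    case (elim n)
    then show ?case
      using tree_closer_neighbour_unique[OF tree assms(1,2), of "root_ray n"] assms(3,4) by linarith
  qed
  then show ?thesis by simp
qed

text \<open>
  The first step of a geodesic from \<open>x\<close> towards a far vertex of the root ray gains one level: at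
  least one because the distance drops, at most one because levels of neighbours differ by at most one.
\<close>

lemma rising_neighbour_exists: "\<exists>y. E x y \<and> level y = level x + 1"
proof -
  have "\<forall>\<^sub>F n in sequentially. \<exists>y. E x y \<and> level y = level x + 1"
    using level_eventually[of x] eventually_gt_at_top[of "nat (level x)"]
  proof eventually_elim
    case (elim n)
    then have "graph_dist E x (root_ray n) \<noteq> 0" by linarith
    moreover have "graph_dist E (root_ray n) (root_ray n) = 0" using root_ray_dist[of n 0] by simp
    ultimately have "x \<noteq> root_ray n" by metis
    then obtain z where z: "E x z"
      "graph_dist E x (root_ray n) = Suc (graph_dist E z (root_ray n))"
      using closer_neighbour_exists[OF connected] by blast
    then have "level z = level x + 1"
      using elim(1) level_ge[of n z] level_edge_le[OF z(1)] by linarith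
    then show ?case using z(1) by blast
  qed
  then show ?thesis by simp
qed

lemma parent_edge: "E x (parent x)" and level_parent: "level (parent x) = level x + 1"
proof -
  have "\<exists>!y. E x y \<and> level y = level x + 1"
    by (rule ex_ex1I[OF rising_neighbour_exists]) (rule rising_neighbour_unique[of x], auto)
  from theI'[OF this] show "E x (parent x)" "level (parent x) = level x + 1"
    unfolding parent_def by auto
qed

lemma edge_iff: "E x y \<longleftrightarrow> y = parent x \<or> x = parent y"
proof
  assume e: "E x y"
  show "y = parent x \<or> x = parent y"
  proof (cases "level x \<le> level y")
    case True
    then show ?thesis
      using rising_neighbour_unique[OF e parent_edge True] level_parent[of x] by simp
  next
    case False
    then show ?thesis
      using rising_neighbour_unique[OF E_sym[OF e] parent_edge] level_parent[of y] by simp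
  qed
qed (use parent_edge E_sym in auto)

lemma succs_eq: "succs x = {y. parent y = x}"
proof -
  have "parent (parent x) \<noteq> x" using level_parent[of x] level_parent[of "parent x"] by force
  then show ?thesis unfolding succs_def by (auto simp: edge_iff)
qed

lemma finite_succs: "finite (succs x)" and card_succs: "card (succs x) = q"
proof -
  have fin: "finite {y. E x y}" by (rule card_ge_0_finite) (simp add: regular)
  have eq: "{y. E x y} = insert (parent x) (succs x)" "parent x \<notin> succs x"
    using parent_edge[of x] by (auto simp: succs_def)
  show f: "finite (succs x)" using fin eq(1) by simp
  show "card (succs x) = q" using regular[of x] eq f by simp
qed

lemma level_parent_iter: "level ((parent ^^ n) x) = level x + int n"
  by (induction n) (auto simp: level_parent)

lemma succs_iter_eq: "succs_iter n x = {y. (parent ^^ n) y = x}"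
proof (induction n)
  case (Suc n)
  then show ?case by (simp add: succs_eq set_eq_iff del: funpow.simps(2)) (simp add: funpow_swap1[of parent])
qed simp

lemma finite_succs_iter: "finite (succs_iter n x)"
  by (induction n) (auto intro: finite_succs)

lemma card_succs_iter: "card (succs_iter n x) = q ^ n"
proof (induction n)
  case (Suc n)
  have "card (succs_iter (Suc n) x) = (\<Sum>y\<in>succs_iter n x. card (succs y))"
    unfolding succs_iter.simps
  proof (rule card_UN_disjoint)
    show "\<forall>i\<in>succs_iter n x. \<forall>j\<in>succs_iter n x. i \<noteq> j \<longrightarrow> succs i \<inter> succs j = {}"
      by (auto simp: succs_eq)
  qed (simp_all add: finite_succs_iter finite_succs)
  then show ?case by (simp add: card_succs Suc)
qed simp

lemma sector_eq: "sector x = {y. \<exists>k. (parent ^^ k) y = x}"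
  by (auto simp: sector_def succs_iter_eq)

lemma level_onto: "\<exists>x. level x = k"
proof (cases "k \<ge> level ref")
  case True
  then have "level ((parent ^^ nat (k - level ref)) ref) = k" by (simp add: level_parent_iter)
  then show ?thesis by blast
next
  case False
  define n where "n = nat (level ref - k)"
  have "card (succs_iter n ref) \<noteq> 0" using q_ge_2 by (simp add: card_succs_iter)
  then have "succs_iter n ref \<noteq> {}" by (metis card.empty)
  then obtain y where "(parent ^^ n) y = ref" by (auto simp: succs_iter_eq)
  then have "level y = k" using level_parent_iter[of n y] False by (simp add: n_def)
  then show ?thesis by blast
qed

lemma common_ancestor: "\<exists>n k. (parent ^^ n) x = (parent ^^ k) y"
  using connected[rule_format, of x y]
proof (induction rule: rtranclp_induct)
  case base
  then show ?case by blast
next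
  case (step y z)
  then obtain n k where nk: "(parent ^^ n) x = (parent ^^ k) y" by blast
  from step(2) consider "z = parent y" | "y = parent z" by (auto simp: edge_iff)
  then show ?case
  proof cases
    case 1
    then have "(parent ^^ Suc n) x = (parent ^^ k) z" using nk by (simp add: funpow_swap1[of parent])
    then show ?thesis by blast
  next
    case 2
    then have "(parent ^^ n) x = (parent ^^ Suc k) z" using nk by (simp add: funpow_swap1[of parent])
    then show ?thesis by blast
  qed
qed

end

section \<open>A Schur test for nonnegative kernels\<close>

text \<open>
  Jensen's inequality for \<open>\<lambda>u. u powr p\<close> with respect to the weights \<open>\<mu>\<close>. Indices with \<open>g y = 0\<close> contribute
  nothing to the sums over \<open>g\<close> and are split off, so that convexity is needed on the open half-line only.
\<close>

lemma weighted_sum_powr_le: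
  fixes \<mu> g :: "'a \<Rightarrow> real"
  assumes fin: "finite Y" and p: "p \<ge> 1"
    and \<mu>: "\<And>y. y \<in> Y \<Longrightarrow> \<mu> y > 0" and g: "\<And>y. y \<in> Y \<Longrightarrow> g y \<ge> 0"
  shows "(\<Sum>y\<in>Y. \<mu> y * g y) powr p \<le> (\<Sum>y\<in>Y. \<mu> y) powr (p - 1) * (\<Sum>y\<in>Y. \<mu> y * g y powr p)"
proof -
  define Z where "Z = {y \<in> Y. g y > 0}"
  have finZ: "finite Z" and ZY: "Z \<subseteq> Y" using fin by (auto simp: Z_def)
  have sum_g: "(\<Sum>y\<in>Y. \<mu> y * g y) = (\<Sum>y\<in>Z. \<mu> y * g y)"
    using g by (intro sum.mono_neutral_right) (auto simp: fin Z_def less_le)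
  have rhs: "(\<Sum>y\<in>Y. \<mu> y * g y powr p) = (\<Sum>y\<in>Z. \<mu> y * g y powr p)"
    using g by (intro sum.mono_neutral_right) (auto simp: fin Z_def less_le)
  show ?thesis
  proof (cases "Z = {}")
    case True
    then show ?thesis using p by (simp add: sum_g rhs)
  next
    case False
    define M where "M = sum \<mu> Z"
    have M: "M > 0" unfolding M_def using False ZY \<mu> finZ by (intro sum_pos) auto
    have "(\<Sum>y\<in>Z. (\<mu> y / M) *\<^sub>R g y) powr p \<le> (\<Sum>y\<in>Z. \<mu> y / M * g y powr p)"
    proof (rule convex_on_sum[OF finZ False powr_convex[OF p]])
      show "(\<Sum>y\<in>Z. \<mu> y / M) = 1" using M by (simp add: M_def flip: sum_divide_distrib)
      show "\<mu> y / M \<ge> 0" "g y \<in> {0<..}" if "y \<in> Z" for y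
        using that M \<mu>[of y] ZY by (auto simp: Z_def less_imp_le)
    qed
    then have "((\<Sum>y\<in>Z. \<mu> y * g y) / M) powr p \<le> (\<Sum>y\<in>Z. \<mu> y * g y powr p) / M"
      by (simp add: sum_divide_distrib)
    then have "(\<Sum>y\<in>Z. \<mu> y * g y) powr p \<le> M powr p * ((\<Sum>y\<in>Z. \<mu> y * g y powr p) / M)"
      using M ZY g \<mu> by (subst (asm) powr_divide) 
        (auto simp: divide_le_eq mult.commute subset_iff less_imp_le intro!: sum_nonneg)
    also have "\<dots> = M powr (p - 1) * (\<Sum>y\<in>Z. \<mu> y * g y powr p)"
      using M by (simp add: powr_diff)
    also have "\<dots> \<le> (\<Sum>y\<in>Y. \<mu> y) powr (p - 1) * (\<Sum>y\<in>Z. \<mu> y * g y powr p)"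
      using M p ZY \<mu> fin unfolding M_def
      by (intro mult_right_mono powr_mono2 sum_mono2 sum_nonneg) (auto simp: less_imp_le subset_iff)
    finally show ?thesis by (simp add: sum_g rhs)
  qed
qed

lemma has_sum_finite_sum:
  assumes "\<And>x. x \<in> X \<Longrightarrow> (f x has_sum g x) A"
  shows "((\<lambda>y. \<Sum>x\<in>X. f x y) has_sum (\<Sum>x\<in>X. g x :: 'a :: topological_comm_monoid_add)) A"
  using assms by (induction X rule: infinite_finite_induct) (auto intro!: has_sum_add)

text \<open>
  The kernel is split as \<open>\<mu>\<close> times \<open>G / \<mu>\<close>. Jensen's inequality in each row costs a factor
  \<open>\<Lambda> powr (p - 1)\<close>, the bound on the row sums of \<open>\<mu>\<close>; what remains is a multiple of \<open>\<nu>\<close>, whose column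
  sums contribute the last factor \<open>\<Lambda>\<close>. Using two weights \<open>\<mu>\<close>, \<open>\<nu>\<close> instead of a Schur test function treats
  \<open>p = 1\<close> together with \<open>p > 1\<close>. Convergence of the rows is part of the conclusion, which is why all
  estimates are made on finite sets first.
\<close>

lemma Schur_test:
  fixes G \<mu> \<nu> :: "'a \<Rightarrow> 'b \<Rightarrow> real" and v :: "'a \<Rightarrow> real" and w F :: "'b \<Rightarrow> real"
  assumes p: "p \<ge> 1"
    and G: "\<And>x y. G x y \<ge> 0" and \<mu>: "\<And>x y. \<mu> x y > 0" and \<nu>: "\<And>x y. \<nu> x y \<ge> 0"
    and v: "\<And>x. v x > 0" and w: "\<And>y. w y \<ge> 0" and F: "\<And>y. F y \<ge> 0"
    and kernel: "\<And>x y. v x * G x y powr p \<le> \<mu> x y powr (p - 1) * \<nu> x y * w y"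
    and rows: "\<And>x Y. finite Y \<Longrightarrow> (\<Sum>y\<in>Y. \<mu> x y) \<le> \<Lambda>"
    and columns: "\<And>y X. finite X \<Longrightarrow> (\<Sum>x\<in>X. \<nu> x y) \<le> \<Lambda>"
    and F_sum: "(\<lambda>y. w y * F y powr p) summable_on UNIV"
  shows "(\<lambda>y. G x y * F y) summable_on UNIV"
    and "(\<lambda>x. v x * (\<Sum>\<^sub>\<infinity>y. G x y * F y) powr p) summable_on UNIV"
    and "(\<Sum>\<^sub>\<infinity>x. v x * (\<Sum>\<^sub>\<infinity>y. G x y * F y) powr p) \<le> \<Lambda> powr p * (\<Sum>\<^sub>\<infinity>y. w y * F y powr p)"
proof -
  have \<Lambda>: "\<Lambda> \<ge> 0" using columns[of "{}"] by simp
  have \<nu>_le: "\<nu> x y \<le> \<Lambda>" for x y using columns[of "{x}" y] by simp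
  have sum_\<nu>: "(\<lambda>y. \<nu> x y * (w y * F y powr p)) summable_on UNIV" for x
    by (rule summable_on_comparison_test[OF summable_on_cmult_right[OF F_sum, of \<Lambda>]])
       (auto intro!: mult_right_mono \<nu>_le mult_nonneg_nonneg \<nu> w)
  define B where "B x = (\<Sum>\<^sub>\<infinity>y. \<nu> x y * (w y * F y powr p))" for x
  have finite_row: "v x * (\<Sum>y\<in>Y. G x y * F y) powr p \<le> \<Lambda> powr (p - 1) * B x"
    if "finite Y" for x Y
  proof -
    have "(\<Sum>y\<in>Y. G x y * F y) powr p = (\<Sum>y\<in>Y. \<mu> x y * (G x y * F y / \<mu> x y)) powr p"
      using \<mu> by (simp add: less_imp_neq[symmetric])
    also have "\<dots> \<le> (\<Sum>y\<in>Y. \<mu> x y) powr (p - 1) * (\<Sum>y\<in>Y. \<mu> x y * (G x y * F y / \<mu> x y) powr p)"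
      by (intro weighted_sum_powr_le that p \<mu> divide_nonneg_pos mult_nonneg_nonneg G F)
    also have "\<dots> \<le> \<Lambda> powr (p - 1) * (\<Sum>y\<in>Y. \<mu> x y * (G x y * F y / \<mu> x y) powr p)"
      using p by (intro mult_right_mono powr_mono2 rows that sum_nonneg mult_nonneg_nonneg)
        (auto intro: less_imp_le \<mu>)
    finally have "v x * (\<Sum>y\<in>Y. G x y * F y) powr p
        \<le> \<Lambda> powr (p - 1) * (\<Sum>y\<in>Y. v x * (\<mu> x y * (G x y * F y / \<mu> x y) powr p))"
      using v[of x] by (simp add: sum_distrib_left[symmetric] mult.left_commute)
    also have "\<dots> \<le> \<Lambda> powr (p - 1) * (\<Sum>y\<in>Y. \<nu> x y * (w y * F y powr p))"
    proof (intro mult_left_mono sum_mono)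
      fix y
      have "v x * (\<mu> x y * (G x y * F y / \<mu> x y) powr p)
          = (v x * G x y powr p) * (F y powr p / \<mu> x y powr (p - 1))"
        using G[of x y] F[of y] \<mu>[of x y] by (simp add: powr_divide powr_mult powr_diff)
      also have "\<dots> \<le> (\<mu> x y powr (p - 1) * \<nu> x y * w y) * (F y powr p / \<mu> x y powr (p - 1))"
        by (intro mult_right_mono kernel) auto
      also have "\<dots> = \<nu> x y * (w y * F y powr p)"
        using \<mu>[of x y] by simp
      finally show "v x * (\<mu> x y * (G x y * F y / \<mu> x y) powr p) \<le> \<nu> x y * (w y * F y powr p)" .
    qed simp
    also have "\<dots> \<le> \<Lambda> powr (p - 1) * B x"
      unfolding B_def
      by (intro mult_left_mono finite_sum_le_infsum sum_\<nu> that) (auto intro!: mult_nonneg_nonneg \<nu> w)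
    finally show ?thesis .
  qed
  have B: "B x \<ge> 0" for x unfolding B_def by (auto intro!: infsum_nonneg mult_nonneg_nonneg \<nu> w)
  have row_bound: "(\<Sum>y\<in>Y. G x y * F y) \<le> (\<Lambda> powr (p - 1) * B x / v x) powr (1 / p)"
    if "finite Y" for x Y
  proof -
    have nn: "(\<Sum>y\<in>Y. G x y * F y) \<ge> 0" by (auto intro!: sum_nonneg mult_nonneg_nonneg G F)
    have "(\<Sum>y\<in>Y. G x y * F y) powr p \<le> \<Lambda> powr (p - 1) * B x / v x"
      using finite_row[OF that, of x] v[of x] by (simp add: pos_le_divide_eq mult.commute)
    then have "((\<Sum>y\<in>Y. G x y * F y) powr p) powr (1 / p) \<le> (\<Lambda> powr (p - 1) * B x / v x) powr (1 / p)"
      using p by (intro powr_mono2) auto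
    then show ?thesis using p nn by (simp add: powr_powr)
  qed
  show row_sum: "(\<lambda>y. G x y * F y) summable_on UNIV" for x
    by (rule nonneg_bdd_above_summable_on)
       (use row_bound[of _ x] in \<open>auto intro!: bdd_aboveI2 mult_nonneg_nonneg G F\<close>)
  define N where "N x = (\<Sum>\<^sub>\<infinity>y. G x y * F y)" for x
  have N: "N x \<ge> 0" for x unfolding N_def by (auto intro!: infsum_nonneg mult_nonneg_nonneg G F)
  have N_bound: "v x * N x powr p \<le> \<Lambda> powr (p - 1) * B x" for x
  proof -
    have "N x \<le> (\<Lambda> powr (p - 1) * B x / v x) powr (1 / p)"
      unfolding N_def by (rule infsum_le_finite_sums[OF row_sum row_bound])
    then have "N x powr p \<le> ((\<Lambda> powr (p - 1) * B x / v x) powr (1 / p)) powr p"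
      using p N by (intro powr_mono2) auto
    also have "\<dots> = \<Lambda> powr (p - 1) * B x / v x"
      using p B[of x] v[of x] by (simp add: powr_powr)
    finally show ?thesis using v[of x] by (simp add: pos_le_divide_eq mult.commute)
  qed
  have total: "(\<Sum>x\<in>X. v x * N x powr p) \<le> \<Lambda> powr p * (\<Sum>\<^sub>\<infinity>y. w y * F y powr p)" if "finite X" for X
  proof -
    have sums: "((\<lambda>y. \<Sum>x\<in>X. \<nu> x y * (w y * F y powr p)) has_sum (\<Sum>x\<in>X. B x)) UNIV"
      unfolding B_def by (intro has_sum_finite_sum has_sum_infsum sum_\<nu>)
    have "(\<Sum>x\<in>X. v x * N x powr p) \<le> \<Lambda> powr (p - 1) * (\<Sum>x\<in>X. B x)"
      unfolding sum_distrib_left by (intro sum_mono N_bound)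
    also have "(\<Sum>x\<in>X. B x) = (\<Sum>\<^sub>\<infinity>y. \<Sum>x\<in>X. \<nu> x y * (w y * F y powr p))"
      using infsumI[OF sums] by simp
    also have "\<dots> \<le> (\<Sum>\<^sub>\<infinity>y. \<Lambda> * (w y * F y powr p))"
    proof (rule infsum_mono)
      show "(\<lambda>y. \<Sum>x\<in>X. \<nu> x y * (w y * F y powr p)) summable_on UNIV"
        using sums by (rule has_sum_imp_summable)
      show "(\<lambda>y. \<Lambda> * (w y * F y powr p)) summable_on UNIV" by (rule summable_on_cmult_right[OF F_sum])
      show "(\<Sum>x\<in>X. \<nu> x y * (w y * F y powr p)) \<le> \<Lambda> * (w y * F y powr p)" for y
        unfolding sum_distrib_right[symmetric]
        by (intro mult_right_mono columns that) (auto intro!: mult_nonneg_nonneg w)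
    qed
    also have "\<dots> = \<Lambda> * (\<Sum>\<^sub>\<infinity>y. w y * F y powr p)" by (rule infsum_cmult_right')
    finally have "(\<Sum>x\<in>X. v x * N x powr p) \<le> \<Lambda> powr (p - 1) * \<Lambda> * (\<Sum>\<^sub>\<infinity>y. w y * F y powr p)"
      by (simp add: mult_left_mono mult.assoc)
    also have "\<Lambda> powr (p - 1) * \<Lambda> = \<Lambda> powr p"
      using \<Lambda> by (cases "\<Lambda> = 0") (auto simp: powr_diff)
    finally show ?thesis .
  qed
  show out_sum: "(\<lambda>x. v x * (\<Sum>\<^sub>\<infinity>y. G x y * F y) powr p) summable_on UNIV"
    by (rule nonneg_bdd_above_summable_on)
       (use total in \<open>auto intro!: bdd_aboveI2 mult_nonneg_nonneg less_imp_le[OF v] simp: N_def\<close>)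
  show "(\<Sum>\<^sub>\<infinity>x. v x * (\<Sum>\<^sub>\<infinity>y. G x y * F y) powr p) \<le> \<Lambda> powr p * (\<Sum>\<^sub>\<infinity>y. w y * F y powr p)"
    by (rule infsum_le_finite_sums[OF out_sum]) (use total in \<open>simp add: N_def\<close>)
qed

section \<open>Lebesgue spaces over weighted point measures\<close>

lemma integrable_count_space_iff_summable_on:
  fixes g :: "'v \<Rightarrow> real"
  assumes "\<And>x. g x \<ge> 0"
  shows "integrable (count_space UNIV) g \<longleftrightarrow> g summable_on UNIV"
  using abs_summable_equivalent[of g UNIV] assms
  by (simp add: Infinite_Set_Sum.abs_summable_on_def)

lemma Lp_space_point_measure:
  fixes w :: "'v \<Rightarrow> real"
  assumes w: "\<And>x. w x \<ge> 0"
  shows "f \<in> Lp_space p (point_measure UNIV (\<lambda>x. ennreal (w x))) \<longleftrightarrow>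
           (\<lambda>x. w x * norm (f x) powr p) summable_on UNIV"
proof -
  have "integrable (point_measure UNIV (\<lambda>x. ennreal (w x))) (\<lambda>x. norm (f x) powr p) \<longleftrightarrow>
        integrable (count_space UNIV) (\<lambda>x. w x * norm (f x) powr p)"
    unfolding point_measure_def by (subst integrable_density) (auto simp: w)
  also have "\<dots> \<longleftrightarrow> (\<lambda>x. w x * norm (f x) powr p) summable_on UNIV"
    by (rule integrable_count_space_iff_summable_on) (simp add: w)
  finally show ?thesis by (simp add: Lp_space_def measurable_def space_point_measure sets_point_measure)
qed

lemma Lp_norm_point_measure:
  fixes w :: "'v \<Rightarrow> real"
  assumes w: "\<And>x. w x \<ge> 0" and f: "f \<in> Lp_space p (point_measure UNIV (\<lambda>x. ennreal (w x)))"
  shows "Lp_norm p (point_measure UNIV (\<lambda>x. ennreal (w x))) f =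
           (\<Sum>\<^sub>\<infinity>x. w x * norm (f x) powr p) powr (1 / p)"
proof -
  let ?g = "\<lambda>x. w x * norm (f x) powr p"
  have "integrable (count_space UNIV) ?g"
    using f by (simp add: Lp_space_point_measure w integrable_count_space_iff_summable_on)
  then have "infsetsum ?g UNIV = (\<Sum>\<^sub>\<infinity>x. ?g x)"
    by (intro infsetsum_infsum) (simp add: Infinite_Set_Sum.abs_summable_on_def)
  moreover have "(\<integral>x. norm (f x) powr p \<partial>point_measure UNIV (\<lambda>x. ennreal (w x))) =
        infsetsum ?g UNIV"
    unfolding point_measure_def infsetsum_def
    by (subst integral_density) (auto simp: w)
  ultimately show ?thesis by (simp add: Lp_norm_def)
qed

section \<open>Common ancestors\<close>

context homogeneous_flow_tree
begin

lemma q_gt_1: "real q > 1" using q_ge_2 by simp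

lemma m_eq_powr: "m x = real q powr level x"
  using q_gt_1 by (simp add: m_def powr_real_of_int')

lemma mass_eq_powr: "m x * \<sigma> j (level x) = real q powr (j * level x)"
  by (simp add: m_eq_powr \<sigma>_def algebra_simps flip: powr_add)

lemma q_powr_less_1_iff: "real q powr t < 1 \<longleftrightarrow> t < 0"
  using q_gt_1 by (metis powr_less_cancel_iff powr_zero_eq_one not_one_less_zero less_trans zero_less_one)

lemma q_powr_mult_nat: "real q powr (t * real n) = (real q powr t) ^ n"
  using q_gt_1 by (simp add: powr_powr[symmetric] powr_realpow)

text \<open>
  The number of steps from \<open>x\<close> up to the lowest common ancestor of \<open>x\<close> and \<open>y\<close>. It is \<open>0\<close> exactly if \<open>x\<close> is
  an ancestor of \<open>y\<close> or equal to \<open>y\<close>.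
\<close>

definition climb :: "'v \<Rightarrow> 'v \<Rightarrow> nat" where
  "climb x y = (LEAST n. \<exists>k. (parent ^^ n) x = (parent ^^ k) y)"

lemma climb_le: "(parent ^^ n) x = (parent ^^ k) y \<Longrightarrow> climb x y \<le> n"
  unfolding climb_def by (rule Least_le) blast

text \<open>
  The two minimal climbs are defined separately. They end at the same vertex because either number of
  steps in a meeting pair determines the other through the levels.
\<close>

lemma climb_meet: "(parent ^^ climb x y) x = (parent ^^ climb y x) y"
proof -
  have ex: "\<exists>k. (parent ^^ climb x y) x = (parent ^^ k) y" for x y
    unfolding climb_def by (rule LeastI_ex) (rule common_ancestor)
  obtain k where k: "(parent ^^ climb x y) x = (parent ^^ k) y" using ex by blast
  obtain i where i: "(parent ^^ climb y x) y = (parent ^^ i) x" using ex by blast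
  have "climb y x \<le> k" "climb x y \<le> i"
    using climb_le[OF k[symmetric]] climb_le[OF i[symmetric]] by auto
  moreover have "level x + climb x y = level y + k" "level y + climb y x = level x + i"
    using arg_cong[OF k, of level] arg_cong[OF i, of level] by (simp_all add: level_parent_iter)
  ultimately have "k = climb y x" by linarith
  then show ?thesis using k by simp
qed

lemma level_climb: "level x + int (climb x y) = level y + int (climb y x)"
  using arg_cong[OF climb_meet[of x y], of level] by (simp add: level_parent_iter)

lemma climb_ancestor: "climb ((parent ^^ k) y) y = 0" "climb y ((parent ^^ k) y) = k"
proof -
  show "climb ((parent ^^ k) y) y = 0" using climb_le[of 0 "(parent ^^ k) y" k y] by simp
  then show "climb y ((parent ^^ k) y) = k"
    using level_climb[of y "(parent ^^ k) y"] by (simp add: level_parent_iter)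
qed

lemma sector_ancestor_iff: "y \<in> sector ((parent ^^ n) x) \<longleftrightarrow> climb x y \<le> n"
proof
  show "y \<in> sector ((parent ^^ n) x) \<Longrightarrow> climb x y \<le> n"
    by (auto simp: sector_eq intro: climb_le sym)
  assume "climb x y \<le> n"
  then obtain i where n: "n = i + climb x y" by (metis le_add_diff_inverse2)
  have "(parent ^^ (i + climb y x)) y = (parent ^^ n) x"
    unfolding n funpow_add by (simp add: climb_meet)
  then show "y \<in> sector ((parent ^^ n) x)" by (auto simp: sector_eq)
qed

lemma level_ancestor_inj: "level ((parent ^^ j) x) = level ((parent ^^ k) x) \<Longrightarrow> j = k"
  by (simp add: level_parent_iter)

text \<open>
  At most \<open>q ^ k\<close> vertices \<open>y\<close> have \<open>climb x y = n\<close> and \<open>climb y x = k\<close>, since they are \<open>k\<close> generations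
  below the \<open>n\<close>-th ancestor of \<open>x\<close>. This count turns \<open>t - 1\<close> into \<open>t\<close> and leaves a product of two geometric
  series.
\<close>

lemma sum_climb_le:
  fixes s t :: real
  assumes s: "s < 0" and t: "t < 0" and Y: "finite Y"
  shows "(\<Sum>y\<in>Y. real q powr (s * climb x y + (t - 1) * climb y x))
           \<le> 1 / ((1 - real q powr s) * (1 - real q powr t))"
proof -
  let ?g = "\<lambda>(n, k). real q powr (s * real n + (t - 1) * real k)"
  let ?h = "\<lambda>y. (climb x y, climb y x)"
  have "finite ((\<lambda>y. climb x y + climb y x) ` Y)" using Y by simp
  then obtain M where "\<forall>k \<in> (\<lambda>y. climb x y + climb y x) ` Y. k < M"
    unfolding finite_nat_set_iff_bounded by blast
  then have M: "climb x y + climb y x < M" if "y \<in> Y" for y using that by blast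
  have r: "0 \<le> real q powr s" "real q powr s < 1" "0 \<le> real q powr t" "real q powr t < 1"
    using s t by (auto simp: q_powr_less_1_iff)
  have geom: "(\<Sum>n<M. r ^ n) \<le> 1 / (1 - r)" if "0 \<le> r" "r < 1" for r :: real
    using sum_le_suminf[of "\<lambda>n. r ^ n" "{..<M}"] that
    by (simp add: suminf_geometric summable_geometric)
  have "(\<Sum>y\<in>Y. ?g (?h y)) =
      (\<Sum>z\<in>{..<M} \<times> {..<M}. of_nat (card {y\<in>Y. ?h y = z}) * ?g z)"
    by (rule sum_fun_comp) (use Y M in \<open>force+\<close>)
  also have "\<dots> \<le> (\<Sum>(n, k)\<in>{..<M} \<times> {..<M}. (real q powr s) ^ n * (real q powr t) ^ k)"
  proof (rule sum_mono)
    fix z :: "nat \<times> nat"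
    obtain n k where z: "z = (n, k)" by fastforce
    have "{y\<in>Y. ?h y = (n, k)} \<subseteq> succs_iter k ((parent ^^ n) x)"
      using climb_meet[of x] by (auto simp: succs_iter_eq)
    then have "card {y\<in>Y. ?h y = (n, k)} \<le> card (succs_iter k ((parent ^^ n) x))"
      by (rule card_mono[OF finite_succs_iter])
    then have "real (card {y\<in>Y. ?h y = (n, k)}) \<le> real (q ^ k)"
      unfolding card_succs_iter by (rule of_nat_mono)
    also have "real (q ^ k) = real q powr real k" using q_gt_1 by (simp add: powr_realpow)
    finally have "real (card {y\<in>Y. ?h y = (n, k)}) \<le> real q powr real k" .
    then have "real (card {y\<in>Y. ?h y = (n, k)}) * ?g (n, k) \<le> real q powr real k * ?g (n, k)"
      by (intro mult_right_mono) auto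
    also have "\<dots> = (real q powr s) ^ n * (real q powr t) ^ k"
      by (simp add: algebra_simps flip: q_powr_mult_nat powr_add)
    finally show "real (card {y\<in>Y. ?h y = z}) * ?g z
        \<le> (case z of (n, k) \<Rightarrow> (real q powr s) ^ n * (real q powr t) ^ k)" by (simp add: z)
  qed
  also have "\<dots> = (\<Sum>n<M. (real q powr s) ^ n) * (\<Sum>k<M. (real q powr t) ^ k)"
    by (simp add: sum_product sum.cartesian_product)
  also have "\<dots> \<le> 1 / (1 - real q powr s) * (1 / (1 - real q powr t))"
    by (intro mult_mono geom r) (use r in \<open>auto intro!: sum_nonneg\<close>)
  finally show ?thesis by simp
qed

section \<open>The Bergman kernel\<close>

text \<open>
  The case distinction in the definition of \<open>\<Psi>\<close> in terms of climbs. The middle case occurs for at most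
  one \<open>n\<close>: there \<open>y\<close> lies properly below the parent of the \<open>n\<close>-th ancestor of \<open>x\<close>, but under a
  different child.
\<close>

lemma \<Psi>_ancestors:
  "\<Psi> ((parent ^^ Suc n) x) ((parent ^^ n) x) y =
     (if climb x y \<le> n then 1 / m ((parent ^^ n) x) - 1 / m ((parent ^^ Suc n) x)
      else if climb x y = Suc n \<and> climb y x \<noteq> 0 then - 1 / m ((parent ^^ Suc n) x)
      else 0)"
proof -
  let ?z = "(parent ^^ n) x" and ?v = "(parent ^^ Suc n) x"
  have zv: "?z \<in> succs ?v" by (simp add: succs_eq)
  have z_sec: "?z \<in> sector ?z" "?z \<in> sector ?v"
    using climb_le[of 0 ?z 0 ?z] by (auto simp: sector_eq intro: exI[of _ 0] exI[of _ 1])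
  have z_open: "?z \<in> open_sector ?v"
    using z_sec level_ancestor_inj[of n x "Suc n"] by (force simp: open_sector_def)
  \<comment> \<open>The only child of \<open>?v\<close> with \<open>?z\<close> in its sector is \<open>?z\<close> itself, by comparing levels.\<close>
  have only_z: "u = ?z" if u: "u \<in> succs ?v" "?z \<in> sector u" for u
  proof -
    obtain k where k: "(parent ^^ k) ?z = u" using u(2) by (auto simp: sector_eq)
    have "parent u = ?v" using u(1) by (simp add: succs_eq)
    then have "level u = level ?z" using level_parent[of u] level_parent[of ?z] by simp
    then show ?thesis using k level_parent_iter[of k ?z] by simp
  qed
  have child: "(\<exists>u\<in>succs ?v. {y, ?z} \<subseteq> sector u) \<longleftrightarrow> climb x y \<le> n"
    using only_z zv z_sec(1) by (metis insert_subset empty_subsetI sector_ancestor_iff)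
  have "(THE u. u \<in> succs ?v \<and> {y, ?z} \<subseteq> sector u) = ?z" if "climb x y \<le> n"
    using that only_z zv z_sec(1) sector_ancestor_iff[of y n x] by (intro the_equality) auto
  moreover have "{y, ?z} \<subseteq> open_sector ?v \<longleftrightarrow>
      climb x y \<le> n \<or> climb x y = Suc n \<and> climb y x \<noteq> 0"
  proof -
    have "y = ?v \<longleftrightarrow> climb x y = Suc n \<and> climb y x = 0"
    proof
      assume "climb x y = Suc n \<and> climb y x = 0"
      then show "y = ?v" using climb_meet[of x y] by simp
    qed (simp only: climb_ancestor)
    then show ?thesis
      using z_open sector_ancestor_iff[of y "Suc n" x] by (auto simp: open_sector_def)
  qed
  ultimately show ?thesis unfolding \<Psi>_def child by auto
qed

lemma S_eq:
  fixes c :: real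
  assumes "c > 1"
  shows "S n x c = real q powr ((c - 1) * (level x + n)) / (1 - real q powr (1 - c))"
proof -
  have "(\<lambda>k. \<sigma> c (level x + n - int k)) =
        (\<lambda>k. real q powr ((c - 1) * (level x + n)) * (real q powr (1 - c)) ^ k)"
    by (auto simp: \<sigma>_def algebra_simps simp flip: q_powr_mult_nat powr_add)
  moreover have "norm (real q powr (1 - c)) < 1" using assms by (simp add: q_powr_less_1_iff)
  ultimately show ?thesis
    unfolding S_def by (simp add: suminf_mult suminf_geometric summable_geometric)
qed

text \<open>
  With \<open>N = climb x y\<close>, the terms from index \<open>N\<close> on form a geometric series and the terms before
  \<open>N - 1\<close> vanish. The term of index \<open>N - 1\<close>, which exists if \<open>N > 0\<close>, vanishes if \<open>y\<close> is itself the common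
  ancestor and otherwise produces the summand \<open>- q powr (c - 1)\<close>.
\<close>

lemma bergman_kernel_eq:
  fixes c :: real
  assumes c: "c > 1"
  shows "bergman_kernel c x y =
    (1 - real q powr (1 - c)) *
    ((1 - 1 / q) / (1 - real q powr - c) - (if climb x y = 0 \<or> climb y x = 0 then 0 else real q powr (c - 1))) *
    real q powr (- c * (level x + climb x y))"
proof -
  define N where "N = climb x y"
  define D where "D = 1 - real q powr (1 - c)"
  define L :: "nat \<Rightarrow> real" where "L n = level x + n" for n
  define t where "t n = \<Psi> ((parent ^^ Suc n) x) ((parent ^^ n) x) y / S (int n) x c" for n
  define e where "e = (if N = 0 \<or> climb y x = 0 then 0 else real q powr (c - 1))"
  have q: "real q > 1" by (rule q_gt_1)
  have lt1: "real q powr - c < 1" using c by (simp add: q_powr_less_1_iff)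
  have inv_m: "1 / m ((parent ^^ n) x) = real q powr - L n" for n
    by (simp only: L_def m_eq_powr level_parent_iter of_int_add of_int_of_nat_eq powr_minus_divide)
  have t_eq: "t n = D * (\<Psi> ((parent ^^ Suc n) x) ((parent ^^ n) x) y
      * real q powr ((1 - c) * L n))" for n
  proof -
    have "real q powr ((1 - c) * L n) = 1 / real q powr ((c - 1) * L n)"
      using powr_minus_divide[of q "(c - 1) * L n"] by (simp add: algebra_simps)
    then show ?thesis unfolding t_def S_eq[OF c] D_def L_def by (simp del: funpow.simps)
  qed
  have tail: "t (i + N) = D * (1 - 1 / q) * real q powr (- c * L N) * (real q powr - c) ^ i" for i
  proof -
    have "\<Psi> ((parent ^^ Suc (i + N)) x) ((parent ^^ (i + N)) x) y
        = real q powr - L (i + N) - real q powr - L (Suc (i + N))"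
      unfolding \<Psi>_ancestors inv_m by (simp add: N_def)
    also have "real q powr - L (Suc (i + N)) = real q powr (- L (i + N) - 1)"
      by (rule arg_cong[where f = "(powr) (real q)"]) (simp add: L_def)
    also have "\<dots> = real q powr - L (i + N) / q" using q by (simp only: powr_diff powr_one)
    also have "real q powr - L (i + N) - real q powr - L (i + N) / q
        = (1 - 1 / q) * real q powr - L (i + N)" by (simp add: left_diff_distrib)
    finally have "t (i + N) = D * (1 - 1 / q) *
        (real q powr - L (i + N) * real q powr ((1 - c) * L (i + N)))"
      by (simp only: t_eq mult.assoc)
    also have "real q powr - L (i + N) * real q powr ((1 - c) * L (i + N))
        = real q powr (- c * L N) * (real q powr - c) ^ i"
      by (simp add: L_def algebra_simps flip: q_powr_mult_nat powr_add)
    finally show ?thesis by simp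
  qed
  have head: "(\<Sum>n<N. t n) = - D * e * real q powr (- c * L N)"
  proof (cases N)
    case 0
    then show ?thesis by (simp add: e_def)
  next
    case (Suc k)
    have "(\<Sum>n<k. t n) = 0"
      using Suc unfolding t_eq \<Psi>_ancestors N_def[symmetric] by (intro sum.neutral) auto
    moreover have "t k = - D * e * real q powr (- c * L N)"
    proof (cases "climb y x = 0")
      case True
      then show ?thesis using Suc unfolding t_eq \<Psi>_ancestors N_def[symmetric] e_def by simp
    next
      case False
      then have "t k = - D * (real q powr - L N * real q powr ((1 - c) * L k))"
        using Suc inv_m[of "Suc k"] unfolding t_eq \<Psi>_ancestors N_def[symmetric]
        by (simp del: funpow.simps)
      also have "real q powr - L N * real q powr ((1 - c) * L k)
          = real q powr (c - 1) * real q powr (- c * L N)"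
        using Suc by (simp add: L_def algebra_simps flip: powr_add)
      finally show ?thesis using False Suc by (simp add: e_def)
    qed
    ultimately show ?thesis using Suc by simp
  qed
  have "(\<lambda>i. t (i + N)) sums (D * (1 - 1 / q) * real q powr (- c * L N) * (1 / (1 - real q powr - c)))"
    unfolding tail by (intro sums_mult geometric_sums) (use lt1 in simp)
  then have "t sums (D * (1 - 1 / q) * real q powr (- c * L N) * (1 / (1 - real q powr - c))
      + (\<Sum>n<N. t n))"
    by (rule sums_iff_shift[THEN iffD1])
  from sums_unique[OF this]
  have "suminf t = D * (1 - 1 / q) * real q powr (- c * L N) * (1 / (1 - real q powr - c))
      + - D * e * real q powr (- c * L N)"
    unfolding head by (rule sym)
  moreover have "D * k * P * (1 / r) + - D * e * P = D * (k / r - e) * P" for k P r :: real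
    by (simp add: algebra_simps)
  ultimately show ?thesis
    unfolding bergman_kernel_def t_def[symmetric] D_def N_def e_def L_def by simp
qed

text \<open>
  On comparable pairs the exceptional term is absent and a positive constant remains; in general the
  triangle inequality bounds the constant.
\<close>

lemma bergman_kernel_estimates:
  fixes c :: real
  assumes c: "c > 1"
  obtains A B where "A > 0" "B \<ge> A"
    "\<And>x k. bergman_kernel c x ((parent ^^ k) x) = A * real q powr (- c * (level x + k))"
    "\<And>x k. bergman_kernel c ((parent ^^ k) x) x = A * real q powr (- c * (level x + k))"
    "\<And>x y. \<bar>bergman_kernel c x y\<bar> \<le> B * real q powr (- c * (level x + climb x y))"
proof -
  define \<kappa> where "\<kappa> = (1 - real q powr (1 - c))"
  define \<alpha> where "\<alpha> = (1 - 1 / q) / (1 - real q powr - c)"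
  define e where "e x y = (if climb x y = 0 \<or> climb y x = 0 then 0 else real q powr (c - 1))" for x y
  have K: "bergman_kernel c x y = \<kappa> * (\<alpha> - e x y) * real q powr (- c * (level x + climb x y))" for x y
    unfolding \<kappa>_def \<alpha>_def e_def by (rule bergman_kernel_eq[OF c])
  have \<kappa>: "\<kappa> > 0" using c by (simp add: \<kappa>_def q_powr_less_1_iff)
  have \<alpha>: "\<alpha> > 0" unfolding \<alpha>_def using q_gt_1 c
    by (intro divide_pos_pos) (simp_all add: q_powr_less_1_iff)
  show thesis
  proof (rule that[of "\<kappa> * \<alpha>" "\<kappa> * (\<alpha> + real q powr (c - 1))"])
    show "\<kappa> * \<alpha> > 0" using \<kappa> \<alpha> by simp
    show "\<kappa> * (\<alpha> + real q powr (c - 1)) \<ge> \<kappa> * \<alpha>" using \<kappa> by simp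
    show "bergman_kernel c x ((parent ^^ k) x) = \<kappa> * \<alpha> * real q powr (- c * (level x + k))" for x k
      by (simp add: K e_def climb_ancestor)
    show "bergman_kernel c ((parent ^^ k) x) x = \<kappa> * \<alpha> * real q powr (- c * (level x + k))" for x k
      by (simp add: K e_def climb_ancestor level_parent_iter)
    show "\<bar>bergman_kernel c x y\<bar> \<le> \<kappa> * (\<alpha> + real q powr (c - 1)) * real q powr (- c * (level x + climb x y))" for x y
    proof -
      have "\<bar>\<alpha> - e x y\<bar> \<le> \<alpha> + real q powr (c - 1)" using \<alpha> by (auto simp: e_def abs_le_iff)
      then show ?thesis unfolding K abs_mult using \<kappa> by (intro mult_right_mono mult_mono) auto
    qed
  qed
qed

section \<open>Sufficiency for kernels dominated by a power of the confluent level\<close>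

lemma weighted_measure_eq:
  "weighted_measure d = point_measure UNIV (\<lambda>x. ennreal (real q powr (d * level x)))"
  by (simp add: weighted_measure_def mass_eq_powr)

lemma Lp_space_weighted_measure:
  "f \<in> Lp_space p (weighted_measure d) \<longleftrightarrow>
     (\<lambda>x. real q powr (d * level x) * norm (f x) powr p) summable_on UNIV"
  unfolding weighted_measure_eq by (rule Lp_space_point_measure) simp

lemma Lp_norm_weighted_measure:
  "f \<in> Lp_space p (weighted_measure d) \<Longrightarrow> Lp_norm p (weighted_measure d) f =
     (\<Sum>\<^sub>\<infinity>x. real q powr (d * level x) * norm (f x) powr p) powr (1 / p)"
  unfolding weighted_measure_eq by (rule Lp_norm_point_measure) simp_all

text \<open>
  The Bergman operators with an arbitrary kernel \<open>J\<close>, so that \<open>K\<^sub>c\<close> and its absolute value can be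
  treated at once.
\<close>

definition kernel_term :: "('v \<Rightarrow> 'v \<Rightarrow> real) \<Rightarrow> real \<Rightarrow> ('v \<Rightarrow> complex) \<Rightarrow> 'v \<Rightarrow> 'v \<Rightarrow> complex" where
  "kernel_term J b f x y = of_real (J x y) * f y * of_real (m y) * of_real (\<sigma> b (level y))"

definition kernel_op :: "('v \<Rightarrow> 'v \<Rightarrow> real) \<Rightarrow> real \<Rightarrow> real \<Rightarrow> ('v \<Rightarrow> complex) \<Rightarrow> 'v \<Rightarrow> complex" where
  "kernel_op J a b f x = of_real (m x * \<sigma> a (level x)) * (\<Sum>\<^sub>\<infinity>y. kernel_term J b f x y)"

lemma kernel_term_eq:
  "kernel_term J b f x y = of_real (J x y * real q powr (b * level y)) * f y"
  unfolding kernel_term_def mass_eq_powr[symmetric] by simp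

lemma kernel_op_eq:
  "kernel_op J a b f x = of_real (real q powr (a * level x)) * (\<Sum>\<^sub>\<infinity>y. kernel_term J b f x y)"
  unfolding kernel_op_def mass_eq_powr ..

text \<open>
  For \<open>c = a + b\<close> the weighted kernel depends only on \<open>n = climb x y\<close> and \<open>k = climb y x\<close>. The Schur
  weights are chosen so that multiplying \<open>\<mu>\<close> by the number \<open>q ^ k\<close> of vertices in a row block, or \<open>\<nu>\<close> by the number
  \<open>q ^ n\<close> in a column block, gives the same quantity \<open>q powr (s n + t k)\<close>, which bounds the norm of the block
  up to the factor \<open>B\<close>.
\<close>

lemma kernel_op_bounded:
  fixes J :: "'v \<Rightarrow> 'v \<Rightarrow> real" and a b c d p B :: real
  assumes p: "p \<ge> 1"
    and B: "B \<ge> 0" and J: "\<And>x y. \<bar>J x y\<bar> \<le> B * real q powr (- c * (level x + climb x y))"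
    and lower: "- a < (d - 1) / p" and upper: "(d - 1) / p < b - 1" and c: "c = a + b"
  shows "bounded_on_Lp p (weighted_measure d) (kernel_term J b) (kernel_op J a b)"
proof -
  define s where "s = - a - (d - 1) / p"
  define t where "t = (d - 1) / p - (b - 1)"
  have s: "s < 0" and t: "t < 0" using lower upper by (simp_all add: s_def t_def)
  have ps: "p * s = - p * a - (d - 1)" and pt: "p * t = (d - 1) - p * (b - 1)"
    using p by (simp_all add: s_def t_def field_simps)
  define \<Lambda> where "\<Lambda> = 1 / ((1 - real q powr s) * (1 - real q powr t))"
  define G where "G x y = real q powr (- a * climb x y - b * climb y x)" for x y
  define \<mu> where "\<mu> x y = real q powr (s * climb x y + (t - 1) * climb y x)" for x y
  define \<nu> where "\<nu> x y = real q powr ((s - 1) * climb x y + t * climb y x)" for x y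
  define w where "w x = real q powr (d * level x)" for x
  have G_eq: "real q powr (a * level x) * (real q powr (- c * (level x + climb x y)) * real q powr (b * level y))
      = G x y" for x y
  proof -
    have "real_of_int (level y) = level x + climb x y - climb y x" using level_climb[of x y] by linarith
    then show ?thesis
      unfolding G_def c powr_add[symmetric] by (simp only: of_int_add of_int_diff of_int_of_nat_eq) (simp add: algebra_simps)
  qed
  \<comment> \<open>Both sides are powers of \<open>q\<close>, and in fact equal: \<open>s\<close> and \<open>t\<close> solve the linear equations in the exponents.\<close>
  have schur_kernel: "w x * G x y powr p \<le> \<mu> x y powr (p - 1) * \<nu> x y * w y" for x y
  proof -
    define n k where "n = real (climb x y)" and "k = real (climb y x)"
    have y: "real_of_int (level y) = level x + n - k"
      using level_climb[of x y] unfolding n_def k_def by linarith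
    have "d * level x + (- a * n - b * k) * p
        = (s * n + (t - 1) * k) * (p - 1) + ((s - 1) * n + t * k) + d * level y"
    proof -
      have "(s * n + (t - 1) * k) * (p - 1) + ((s - 1) * n + t * k) + d * level y
          = (p * s) * n - n + (p * t) * k - (p - 1) * k + d * level y"
        by (simp add: algebra_simps)
      then show ?thesis unfolding ps pt y by (simp add: algebra_simps)
    qed
    then show ?thesis
      by (simp add: w_def G_def \<mu>_def \<nu>_def powr_powr n_def k_def flip: powr_add)
  qed
  have schur: "(\<lambda>y. G x y * F y) summable_on UNIV"
      "(\<lambda>x. w x * (\<Sum>\<^sub>\<infinity>y. G x y * F y) powr p) summable_on UNIV"
      "(\<Sum>\<^sub>\<infinity>x. w x * (\<Sum>\<^sub>\<infinity>y. G x y * F y) powr p) \<le> \<Lambda> powr p * (\<Sum>\<^sub>\<infinity>y. w y * F y powr p)"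
    if "\<And>y. F y \<ge> 0" "(\<lambda>y. w y * F y powr p) summable_on UNIV" for F x
  proof -
    have rows: "(\<Sum>y\<in>Y. \<mu> x y) \<le> \<Lambda>" if "finite Y" for x Y
      unfolding \<mu>_def \<Lambda>_def by (rule sum_climb_le[OF s t that])
    have columns: "(\<Sum>x\<in>X. \<nu> x y) \<le> \<Lambda>" if "finite X" for y X
      using sum_climb_le[OF t s that, of y] unfolding \<nu>_def \<Lambda>_def by (simp add: add.commute mult.commute)
    have pos: "G x y \<ge> 0" "\<mu> x y > 0" "\<nu> x y \<ge> 0" "w x > 0" "w x \<ge> 0" for x y
      using q_gt_1 by (auto simp: G_def \<mu>_def \<nu>_def w_def)
    note test = Schur_test[of p G \<mu> \<nu> w w F \<Lambda>, OF p pos(1-5) that(1) schur_kernel rows columns that(2)]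
    show "(\<lambda>y. G x y * F y) summable_on UNIV" by (rule test(1))
    show "(\<lambda>x. w x * (\<Sum>\<^sub>\<infinity>y. G x y * F y) powr p) summable_on UNIV" by (rule test(2))
    show "(\<Sum>\<^sub>\<infinity>x. w x * (\<Sum>\<^sub>\<infinity>y. G x y * F y) powr p) \<le> \<Lambda> powr p * (\<Sum>\<^sub>\<infinity>y. w y * F y powr p)"
      by (rule test(3))
  qed
  show ?thesis
    unfolding bounded_on_Lp_def
  proof (intro exI[of _ "B * \<Lambda>"] ballI conjI allI)
    fix f assume f: "f \<in> Lp_space p (weighted_measure d)"
    define F where "F y = norm (f y)" for y
    define R where "R x = (\<Sum>\<^sub>\<infinity>y. G x y * F y)" for x
    have F: "F y \<ge> 0" for y by (simp add: F_def)
    have F_sum: "(\<lambda>y. w y * F y powr p) summable_on UNIV"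
      using f unfolding Lp_space_weighted_measure w_def F_def .
    have R: "R x \<ge> 0" for x
      unfolding R_def by (intro infsum_nonneg) (simp add: G_def F_def)
    have term_le: "norm (kernel_term J b f x y) \<le> B / real q powr (a * level x) * (G x y * F y)" for x y
    proof -
      have "norm (kernel_term J b f x y) = \<bar>J x y\<bar> * real q powr (b * level y) * F y"
        by (simp add: kernel_term_eq norm_mult abs_mult F_def)
      also have "\<dots> \<le> B * real q powr (- c * (level x + climb x y)) * real q powr (b * level y) * F y"
        by (intro mult_right_mono J) (auto simp: F)
      also have "\<dots> = B / real q powr (a * level x) * (G x y * F y)"
        using q_gt_1 by (simp add: G_eq[symmetric])
      finally show ?thesis .
    qed
    have abs_sum: "(\<lambda>y. norm (kernel_term J b f x y)) summable_on UNIV" for x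
      by (rule summable_on_comparison_test[OF summable_on_cmult_right[OF schur(1)[OF F F_sum]] term_le]) simp
    then show "(\<lambda>y. norm (kernel_term J b f x y)) summable_on UNIV" for x .
    have op_le: "norm (kernel_op J a b f x) \<le> B * R x" for x
    proof -
      have "norm (\<Sum>\<^sub>\<infinity>y. kernel_term J b f x y) \<le> (\<Sum>\<^sub>\<infinity>y. norm (kernel_term J b f x y))"
        by (rule norm_infsum_bound[OF abs_sum])
      also have "\<dots> \<le> (\<Sum>\<^sub>\<infinity>y. B / real q powr (a * level x) * (G x y * F y))"
        by (rule infsum_mono[OF abs_sum summable_on_cmult_right[OF schur(1)[OF F F_sum]] term_le])
      also have "\<dots> = B / real q powr (a * level x) * R x"
        unfolding R_def by (rule infsum_cmult_right')
      finally show ?thesis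
        using q_gt_1 by (simp add: kernel_op_eq norm_mult pos_le_divide_eq mult.commute)
    qed
    have op_powr_le: "w x * norm (kernel_op J a b f x) powr p \<le> B powr p * (w x * R x powr p)" for x
    proof -
      have "w x * norm (kernel_op J a b f x) powr p \<le> w x * (B * R x) powr p"
        using p by (intro mult_left_mono powr_mono2 op_le) (auto simp: w_def)
      then show ?thesis using B R by (simp add: powr_mult mult.left_commute)
    qed
    have R_sum: "(\<lambda>x. w x * R x powr p) summable_on UNIV"
      unfolding R_def by (rule schur(2)[OF F F_sum])
    have op_sum: "(\<lambda>x. w x * norm (kernel_op J a b f x) powr p) summable_on UNIV"
      by (rule summable_on_comparison_test[OF summable_on_cmult_right[OF R_sum] op_powr_le]) (simp add: w_def)
    then show op_Lp: "kernel_op J a b f \<in> Lp_space p (weighted_measure d)"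
      unfolding Lp_space_weighted_measure w_def .
    have "(\<Sum>\<^sub>\<infinity>x. w x * norm (kernel_op J a b f x) powr p) \<le> (\<Sum>\<^sub>\<infinity>x. B powr p * (w x * R x powr p))"
      by (rule infsum_mono[OF op_sum summable_on_cmult_right[OF R_sum] op_powr_le])
    also have "\<dots> = B powr p * (\<Sum>\<^sub>\<infinity>x. w x * R x powr p)" by (rule infsum_cmult_right')
    also have "\<dots> \<le> B powr p * (\<Lambda> powr p * (\<Sum>\<^sub>\<infinity>y. w y * F y powr p))"
      unfolding R_def by (intro mult_left_mono schur(3) F F_sum) simp
    finally have le: "(\<Sum>\<^sub>\<infinity>x. w x * norm (kernel_op J a b f x) powr p)
        \<le> (B powr p * \<Lambda> powr p) * (\<Sum>\<^sub>\<infinity>y. w y * F y powr p)" by simp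
    have "0 < (1 - real q powr s) * (1 - real q powr t)"
      using s t q_powr_less_1_iff[of s] q_powr_less_1_iff[of t] by simp
    then have \<Lambda>: "\<Lambda> \<ge> 0" by (simp add: \<Lambda>_def)
    have "(\<Sum>\<^sub>\<infinity>x. w x * norm (kernel_op J a b f x) powr p) powr (1 / p)
        \<le> ((B powr p * \<Lambda> powr p) * (\<Sum>\<^sub>\<infinity>y. w y * F y powr p)) powr (1 / p)"
      using p by (intro powr_mono2 le infsum_nonneg) (auto simp: w_def)
    also have "\<dots> = B * \<Lambda> * (\<Sum>\<^sub>\<infinity>y. w y * F y powr p) powr (1 / p)"
      using p B \<Lambda> by (subst powr_mult) (auto simp: powr_mult powr_powr w_def intro!: infsum_nonneg)
    finally show "Lp_norm p (weighted_measure d) (kernel_op J a b f) \<le> B * \<Lambda> * Lp_norm p (weighted_measure d) f"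
      unfolding Lp_norm_weighted_measure[OF f] Lp_norm_weighted_measure[OF op_Lp] w_def F_def .
  qed
qed

section \<open>Necessity by testing on comparable pairs\<close>

text \<open>
  The generations below \<open>y\<close> are disjoint because they have different levels, and the \<open>n\<close>-th one has
  \<open>q ^ n\<close> members.
\<close>

lemma sum_truncated_sector:
  assumes "\<And>n x. n < N \<Longrightarrow> (parent ^^ n) x = y \<Longrightarrow> h x = g n"
  shows "(\<Sum>x\<in>(\<Union>n<N. succs_iter n y). h x) = (\<Sum>n<N. real q ^ n * g n)"
proof -
  have "(\<Sum>x\<in>(\<Union>n<N. succs_iter n y). h x) = (\<Sum>n<N. \<Sum>x\<in>succs_iter n y. h x)"
  proof (rule sum.UNION_disjoint)
    have "n = k" if "(parent ^^ n) x = y" "(parent ^^ k) x = y" for n k x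
      using that level_ancestor_inj[of n x k] by simp
    then show "\<forall>n\<in>{..<N}. \<forall>k\<in>{..<N}. n \<noteq> k \<longrightarrow> succs_iter n y \<inter> succs_iter k y = {}"
      by (auto simp: succs_iter_eq)
  qed (auto simp: finite_succs_iter)
  also have "\<dots> = (\<Sum>n<N. real q ^ n * g n)"
  proof (rule sum.cong)
    fix n assume "n \<in> {..<N}"
    then have "(\<Sum>x\<in>succs_iter n y. h x) = (\<Sum>x\<in>succs_iter n y. g n)"
      by (intro sum.cong) (auto simp: succs_iter_eq assms)
    then show "(\<Sum>x\<in>succs_iter n y. h x) = real q ^ n * g n" by (simp add: card_succs_iter)
  qed simp
  finally show ?thesis .
qed

text \<open>
  Boundedness specialised to real functions \<open>g\<close> supported on a finite set \<open>Y\<close>, with the norm of the image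
  replaced by its part on a finite set \<open>X\<close>. Both sides become finite sums.
\<close>

lemma kernel_op_finite_test:
  assumes p: "p \<ge> 1"
    and bdd: "bounded_on_Lp p (weighted_measure d) (kernel_term J b) (kernel_op J a b)"
  obtains D where "D \<ge> 0"
    "\<And>X Y g. finite X \<Longrightarrow> finite Y \<Longrightarrow>
      (\<Sum>x\<in>X. real q powr (d * level x) *
         \<bar>real q powr (a * level x) * (\<Sum>y\<in>Y. J x y * real q powr (b * level y) * g y)\<bar> powr p)
      \<le> D * (\<Sum>y\<in>Y. real q powr (d * level y) * \<bar>g y\<bar> powr p)"
proof -
  obtain C where C: "\<And>f. f \<in> Lp_space p (weighted_measure d) \<Longrightarrow>
      kernel_op J a b f \<in> Lp_space p (weighted_measure d) \<and>
      Lp_norm p (weighted_measure d) (kernel_op J a b f) \<le> C * Lp_norm p (weighted_measure d) f"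
    using bdd unfolding bounded_on_Lp_def by blast
  show thesis
  proof (rule that[of "\<bar>C\<bar> powr p"])
    fix X Y :: "'v set" and g :: "'v \<Rightarrow> real"
    assume X: "finite X" and Y: "finite Y"
    define f :: "'v \<Rightarrow> complex" where "f y = (if y \<in> Y then of_real (g y) else 0)" for y
    define h where "h x = real q powr (a * level x) * (\<Sum>y\<in>Y. J x y * real q powr (b * level y) * g y)" for x
    define w where "w x = real q powr (d * level x)" for x
    have w: "w x \<ge> 0" for x by (simp add: w_def)
    have f_has_sum: "((\<lambda>y. w y * norm (f y) powr p) has_sum (\<Sum>y\<in>Y. w y * \<bar>g y\<bar> powr p)) UNIV"
      by (rule has_sum_finite_neutralI[OF Y]) (auto simp: f_def)
    then have f: "f \<in> Lp_space p (weighted_measure d)"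
      unfolding Lp_space_weighted_measure w_def by (rule has_sum_imp_summable)
    have "(kernel_term J b f x has_sum of_real (\<Sum>y\<in>Y. J x y * real q powr (b * level y) * g y)) UNIV" for x
      by (rule has_sum_finite_neutralI[OF Y]) (auto simp: f_def kernel_term_eq)
    then have op: "kernel_op J a b f x = of_real (h x)" for x
      by (simp add: kernel_op_eq infsumI h_def)
    have op_Lp: "kernel_op J a b f \<in> Lp_space p (weighted_measure d)" using C[OF f] by blast
    then have op_sum: "(\<lambda>x. w x * \<bar>h x\<bar> powr p) summable_on UNIV"
      unfolding Lp_space_weighted_measure op w_def by simp
    have nn: "(\<Sum>y\<in>Y. w y * \<bar>g y\<bar> powr p) \<ge> 0" by (intro sum_nonneg mult_nonneg_nonneg w) simp
    have "(\<Sum>\<^sub>\<infinity>x. w x * \<bar>h x\<bar> powr p) powr (1 / p) \<le> C * (\<Sum>y\<in>Y. w y * \<bar>g y\<bar> powr p) powr (1 / p)"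
      using C[OF f] Lp_norm_weighted_measure[OF f] Lp_norm_weighted_measure[OF op_Lp] infsumI[OF f_has_sum]
      by (simp add: op w_def)
    also have "\<dots> \<le> \<bar>C\<bar> * (\<Sum>y\<in>Y. w y * \<bar>g y\<bar> powr p) powr (1 / p)"
      by (intro mult_right_mono) auto
    finally have "((\<Sum>\<^sub>\<infinity>x. w x * \<bar>h x\<bar> powr p) powr (1 / p)) powr p
        \<le> (\<bar>C\<bar> * (\<Sum>y\<in>Y. w y * \<bar>g y\<bar> powr p) powr (1 / p)) powr p"
      using p by (intro powr_mono2) auto
    moreover have "(\<Sum>\<^sub>\<infinity>x. w x * \<bar>h x\<bar> powr p) \<ge> 0" by (intro infsum_nonneg mult_nonneg_nonneg w) simp
    ultimately have "(\<Sum>\<^sub>\<infinity>x. w x * \<bar>h x\<bar> powr p) \<le> \<bar>C\<bar> powr p * (\<Sum>y\<in>Y. w y * \<bar>g y\<bar> powr p)"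
      using p nn by (simp add: powr_mult powr_powr)
    moreover have "(\<Sum>x\<in>X. w x * \<bar>h x\<bar> powr p) \<le> (\<Sum>\<^sub>\<infinity>x. w x * \<bar>h x\<bar> powr p)"
      using w by (intro finite_sum_le_infsum op_sum X) auto
    ultimately show "(\<Sum>x\<in>X. real q powr (d * level x) *
         \<bar>real q powr (a * level x) * (\<Sum>y\<in>Y. J x y * real q powr (b * level y) * g y)\<bar> powr p)
      \<le> \<bar>C\<bar> powr p * (\<Sum>y\<in>Y. real q powr (d * level y) * \<bar>g y\<bar> powr p)"
      by (simp add: w_def h_def)
  qed simp
qed

text \<open>
  Levels take all integer values, positive and negative, so only the exponent \<open>0\<close> gives a bounded power.
\<close>

lemma powr_bounded_on_levels:
  fixes e T :: real
  assumes "\<And>x. real q powr (e * level x) \<le> T"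
  shows "e = 0"
proof (rule ccontr)
  assume "e \<noteq> 0"
  then have "real q powr \<bar>e\<bar> > 1" using q_gt_1 by simp
  then obtain n where n: "T < (real q powr \<bar>e\<bar>) ^ n" using real_arch_pow by blast
  obtain x where "level x = (if e > 0 then int n else - int n)" using level_onto by blast
  then have "e * level x = \<bar>e\<bar> * real n" using \<open>e \<noteq> 0\<close> by auto
  then show False using assms[of x] n by (simp add: q_powr_mult_nat)
qed

lemma exponent_negative_if_geometric_sums_bounded:
  fixes A T e :: real
  assumes A: "A > 0" and bound: "\<And>N. A * (\<Sum>n<N. real q powr (e * real n)) \<le> T"
  shows "e < 0"
proof (rule ccontr)
  assume "\<not> e < 0"
  then have e: "e \<ge> 0" by simp
  obtain N where N: "T < real N * A" using reals_Archimedean3[OF A] by blast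
  have "real N = (\<Sum>n<N. 1)" by simp
  also have "\<dots> \<le> (\<Sum>n<N. real q powr (e * real n))"
    using e q_gt_1 by (intro sum_mono ge_one_powr_ge_zero) auto
  finally have "real N * A \<le> A * (\<Sum>n<N. real q powr (e * real n))"
    using A by (simp add: mult.commute)
  then show False using bound[of N] N by linarith
qed

text \<open>
  Only pairs of a vertex and one of its ancestors enter, where the kernel is known exactly. For
  such pairs at a vertex \<open>r\<close> of level \<open>0\<close> all weights reduce to powers of \<open>q\<close> in the generation.
\<close>

lemma kernel_op_bounded_necessary:
  fixes J :: "'v \<Rightarrow> 'v \<Rightarrow> real" and a b c d p A :: real
  assumes p: "p \<ge> 1"
    and A: "A > 0"
    and J: "\<And>k x. J x ((parent ^^ k) x) = A * real q powr (- c * (level x + k))"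
      "\<And>k x. J ((parent ^^ k) x) x = A * real q powr (- c * (level x + k))"
    and bdd: "bounded_on_Lp p (weighted_measure d) (kernel_term J b) (kernel_op J a b)"
  shows "- a < (d - 1) / p" "(d - 1) / p < b - 1" "c = a + b"
proof -
  obtain D where D: "D \<ge> 0" and test: "\<And>X Y g. finite X \<Longrightarrow> finite Y \<Longrightarrow>
      (\<Sum>x\<in>X. real q powr (d * level x) *
         \<bar>real q powr (a * level x) * (\<Sum>y\<in>Y. J x y * real q powr (b * level y) * g y)\<bar> powr p)
      \<le> D * (\<Sum>y\<in>Y. real q powr (d * level y) * \<bar>g y\<bar> powr p)"
    using kernel_op_finite_test[OF p bdd] by blast
  have q0: "real q > 0" using q_gt_1 by simp
  have Ap: "A powr p > 0" using A by simp
  \<comment> \<open>A point mass at \<open>x\<close>, evaluated at \<open>x\<close> itself.\<close>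
  have "real q powr ((a + b - c) * level x) \<le> (D / A powr p) powr (1 / p)" for x
  proof -
    have "real q powr (d * level x) * (A * real q powr ((a + b - c) * level x)) powr p
        \<le> real q powr (d * level x) * D"
      using test[of "{x}" "{x}" "\<lambda>_. 1"] J(1)[of x 0] A
      by (simp add: abs_mult algebra_simps flip: powr_add)
    then have "A powr p * (real q powr ((a + b - c) * level x)) powr p \<le> D"
      using q0 A by (simp add: powr_mult)
    then have "(real q powr ((a + b - c) * level x)) powr p \<le> D / A powr p"
      using Ap by (simp add: pos_le_divide_eq mult.commute)
    then have "((real q powr ((a + b - c) * level x)) powr p) powr (1 / p) \<le> (D / A powr p) powr (1 / p)"
      using p by (intro powr_mono2) auto
    then show ?thesis using p by (simp add: powr_powr)
  qed
  then have "a + b - c = 0" by (rule powr_bounded_on_levels)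
  then show c: "c = a + b" by simp
  obtain r where r: "level r = 0" using level_onto by blast
  show "- a < (d - 1) / p"
  proof -
    \<comment> \<open>A point mass at \<open>r\<close>, evaluated on the first \<open>N\<close> generations below \<open>r\<close>.\<close>
    have "A powr p * (\<Sum>n<N. real q powr ((1 - d - p * a) * real n)) \<le> D" for N
    proof -
      have "(\<Sum>x\<in>(\<Union>n<N. succs_iter n r). real q powr (d * level x) *
         \<bar>real q powr (a * level x) * (\<Sum>y\<in>{r}. J x y * real q powr (b * level y) * 1)\<bar> powr p)
         = (\<Sum>n<N. real q ^ n * (A powr p * real q powr ((- d - p * a) * real n)))"
      proof (rule sum_truncated_sector)
        fix n x assume n: "(parent ^^ n) x = r"
        then have lev: "real_of_int (level x) = - real n" using level_parent_iter[of n x] r by simp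
        have "J x r = A" using J(1)[of x n] n lev q0 by simp
        then show "real q powr (d * level x) *
         \<bar>real q powr (a * level x) * (\<Sum>y\<in>{r}. J x y * real q powr (b * level y) * 1)\<bar> powr p
          = A powr p * real q powr ((- d - p * a) * real n)"
          using A q0 by (simp add: lev r abs_mult powr_mult powr_powr algebra_simps flip: powr_add)
      qed
      also have "\<dots> = A powr p * (\<Sum>n<N. real q powr ((1 - d - p * a) * real n))"
        unfolding sum_distrib_left
      proof (rule sum.cong)
        fix n
        have "real q ^ n * real q powr ((- d - p * a) * real n) = real q powr ((1 - d - p * a) * real n)"
          using q0 by (simp add: algebra_simps flip: powr_realpow powr_add)
        then show "real q ^ n * (A powr p * real q powr ((- d - p * a) * real n))
            = A powr p * real q powr ((1 - d - p * a) * real n)" by (simp add: mult.left_commute)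
      qed simp
      finally show ?thesis
        using test[of "\<Union>n<N. succs_iter n r" "{r}" "\<lambda>_. 1"] q0 r by (simp add: finite_succs_iter)
    qed
    then have "1 - d - p * a < 0" by (rule exponent_negative_if_geometric_sums_bounded[OF Ap])
    then show ?thesis using p by (simp add: field_simps)
  qed
  show "(d - 1) / p < b - 1"
  proof (cases "p = 1")
    case True
    \<comment> \<open>A point mass at \<open>r\<close>, evaluated at the first \<open>N\<close> ancestors of \<open>r\<close>.\<close>
    have "A * (\<Sum>k<N. real q powr ((d - b) * real k)) \<le> D" for N
    proof -
      have "(\<Sum>k<N. A * real q powr ((d - b) * real k)) = (\<Sum>x\<in>(\<lambda>k. (parent ^^ k) r) ` {..<N}.
          real q powr (d * level x) *
         \<bar>real q powr (a * level x) * (\<Sum>y\<in>{r}. J x y * real q powr (b * level y) * 1)\<bar> powr p)"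
      proof (rule sum.reindex_cong[symmetric])
        show "inj_on (\<lambda>k. (parent ^^ k) r) {..<N}"
          by (intro inj_onI level_ancestor_inj[of _ r]) simp
        fix k
        show "real q powr (d * level ((parent ^^ k) r)) *
         \<bar>real q powr (a * level ((parent ^^ k) r)) *
           (\<Sum>y\<in>{r}. J ((parent ^^ k) r) y * real q powr (b * level y) * 1)\<bar> powr p
          = A * real q powr ((d - b) * real k)"
          using A q0 by (simp add: True level_parent_iter r J(2) c abs_mult algebra_simps flip: powr_add)
      qed simp
      also have "\<dots> \<le> D"
        using test[of "(\<lambda>k. (parent ^^ k) r) ` {..<N}" "{r}" "\<lambda>_. 1"] q0 r by simp
      finally show ?thesis by (simp add: sum_distrib_left)
    qed
    then have "d - b < 0" by (rule exponent_negative_if_geometric_sums_bounded[OF A])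
    then show ?thesis using True by simp
  next
    case False
    show ?thesis
    proof (rule ccontr)
      assume "\<not> (d - 1) / p < b - 1"
      then have e: "1 - d - p * (1 - b) \<le> 0" using p by (simp add: field_simps)
      have bound: "real N powr (p - 1) \<le> D / A powr p" if "N > 0" for N
      proof -
        \<comment> \<open>The exponent \<open>1 - b\<close> makes every generation contribute the same amount \<open>A\<close> to the image at \<open>r\<close>,
          while by the assumption to be refuted it contributes at most \<open>1\<close> to
          the \<open>p\<close>-th power of the norm.\<close>
        let ?Y = "\<Union>n<N. succs_iter n r" and ?g = "\<lambda>y. real q powr ((1 - b) * level y)"
        have lev: "real_of_int (level y) = - real n" if "(parent ^^ n) y = r" for n y
          using level_parent_iter[of n y] r that by simp
        have "(\<Sum>y\<in>?Y. J r y * real q powr (b * level y) * ?g y) = (\<Sum>n<N. real q ^ n * (A * real q powr - real n))"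
        proof (rule sum_truncated_sector)
          fix n y assume n: "(parent ^^ n) y = r"
          then have "J r y = A" using J(2)[of n y] lev[OF n] q0 by simp
          then show "J r y * real q powr (b * level y) * ?g y = A * real q powr - real n"
            by (simp add: lev[OF n] algebra_simps flip: powr_add)
        qed
        also have "\<dots> = (\<Sum>n<N. A)"
          using q0 by (intro sum.cong) (simp_all add: powr_minus powr_realpow)
        also have "\<dots> = A * real N" by (simp add: mult.commute)
        finally have lhs: "(\<Sum>y\<in>?Y. J r y * real q powr (b * level y) * ?g y) = A * real N" .
        have "(\<Sum>y\<in>?Y. real q powr (d * level y) * \<bar>?g y\<bar> powr p)
            = (\<Sum>n<N. real q ^ n * real q powr ((- d - p * (1 - b)) * real n))"
        proof (rule sum_truncated_sector)
          fix n y assume n: "(parent ^^ n) y = r"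
          show "real q powr (d * level y) * \<bar>?g y\<bar> powr p = real q powr ((- d - p * (1 - b)) * real n)"
            by (simp add: lev[OF n] powr_powr algebra_simps flip: powr_add)
        qed
        also have "\<dots> = (\<Sum>n<N. real q powr ((1 - d - p * (1 - b)) * real n))"
          using q0 by (simp add: algebra_simps flip: powr_realpow powr_add)
        also have "\<dots> \<le> (\<Sum>n<N. 1)"
        proof (rule sum_mono)
          fix n
          have "real q powr ((1 - d - p * (1 - b)) * real n) \<le> real q powr 0"
            using e q_gt_1 by (intro powr_mono mult_nonpos_nonneg) auto
          then show "real q powr ((1 - d - p * (1 - b)) * real n) \<le> 1" using q0 by simp
        qed
        finally have rhs: "(\<Sum>y\<in>?Y. real q powr (d * level y) * \<bar>?g y\<bar> powr p) \<le> real N" by simp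
        have "(A * real N) powr p \<le> D * (\<Sum>y\<in>?Y. real q powr (d * level y) * \<bar>?g y\<bar> powr p)"
          using test[of "{r}" ?Y ?g] A q0 r unfolding lhs by (simp add: finite_succs_iter lhs)
        also have "\<dots> \<le> D * real N" by (rule mult_left_mono[OF rhs D])
        finally have "A powr p * (real N powr (p - 1) * real N) \<le> D * real N"
          using A that by (simp add: powr_mult powr_diff)
        then have "A powr p * real N powr (p - 1) \<le> D" using that by (simp flip: mult.assoc)
        then show ?thesis using Ap by (simp add: pos_le_divide_eq mult.commute)
      qed
      have p1: "p - 1 > 0" using p False by simp
      have "D / A powr p \<ge> 0" using D Ap by simp
      moreover obtain N where N: "real N > (D / A powr p + 1) powr (1 / (p - 1))"
        using reals_Archimedean2 by blast
      ultimately have "((D / A powr p + 1) powr (1 / (p - 1))) powr (p - 1) < real N powr (p - 1)"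
        using p1 by (intro powr_less_mono2) auto
      then have "D / A powr p + 1 < real N powr (p - 1)"
        using p1 \<open>D / A powr p \<ge> 0\<close> by (simp add: powr_powr)
      moreover have "real N > 0" using N powr_ge_zero by (rule order.strict_trans1[rotated])
      then have "N > 0" by simp
      ultimately show False using bound[of N] by linarith
    qed
  qed
qed

lemma kernel_op_bounded_iff:
  fixes J :: "'v \<Rightarrow> 'v \<Rightarrow> real" and a b c d p A B :: real
  assumes "p \<ge> 1" and "A > 0" and "B \<ge> 0"
    and "\<And>k x. J x ((parent ^^ k) x) = A * real q powr (- c * (level x + k))"
    and "\<And>k x. J ((parent ^^ k) x) x = A * real q powr (- c * (level x + k))"
    and "\<And>x y. \<bar>J x y\<bar> \<le> B * real q powr (- c * (level x + climb x y))"
  shows "bounded_on_Lp p (weighted_measure d) (kernel_term J b) (kernel_op J a b) \<longleftrightarrow>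
           - a < (d - 1) / p \<and> (d - 1) / p < b - 1 \<and> c = a + b"
  using kernel_op_bounded[of p B J c a d b] kernel_op_bounded_necessary[of p A J c d b a] assms by blast

section \<open>The Bergman operators\<close>

lemma
  fixes a b c d p :: real
  assumes c: "c > 1" and p: "p \<ge> 1"
  shows U_bounded_iff: "U_bounded a b c p d \<longleftrightarrow> - a < (d - 1) / p \<and> (d - 1) / p < b - 1 \<and> c = a + b"
    and V_bounded_iff: "V_bounded a b c p d \<longleftrightarrow> - a < (d - 1) / p \<and> (d - 1) / p < b - 1 \<and> c = a + b"
proof -
  obtain A B where AB: "A > 0" "B \<ge> A"
    and K: "\<And>x k. bergman_kernel c x ((parent ^^ k) x) = A * real q powr (- c * (level x + k))"
      "\<And>x k. bergman_kernel c ((parent ^^ k) x) x = A * real q powr (- c * (level x + k))"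
      "\<And>x y. \<bar>bergman_kernel c x y\<bar> \<le> B * real q powr (- c * (level x + climb x y))"
    using bergman_kernel_estimates[OF c] by blast
  have B: "B \<ge> 0" using AB by simp
  have "U_term b c = kernel_term (bergman_kernel c) b" "U a b c = kernel_op (bergman_kernel c) a b"
    by (auto simp: fun_eq_iff U_term_def kernel_term_def U_def kernel_op_def)
  then show "U_bounded a b c p d \<longleftrightarrow> - a < (d - 1) / p \<and> (d - 1) / p < b - 1 \<and> c = a + b"
    unfolding U_bounded_def using kernel_op_bounded_iff[OF p AB(1) B K] by simp
  have "V_term b c = kernel_term (\<lambda>x y. \<bar>bergman_kernel c x y\<bar>) b"
    "V a b c = kernel_op (\<lambda>x y. \<bar>bergman_kernel c x y\<bar>) a b"
    by (auto simp: fun_eq_iff V_term_def kernel_term_def V_def kernel_op_def)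
  moreover have "bounded_on_Lp p (weighted_measure d) (kernel_term (\<lambda>x y. \<bar>bergman_kernel c x y\<bar>) b)
      (kernel_op (\<lambda>x y. \<bar>bergman_kernel c x y\<bar>) a b) \<longleftrightarrow>
      - a < (d - 1) / p \<and> (d - 1) / p < b - 1 \<and> c = a + b"
    by (rule kernel_op_bounded_iff[OF p AB(1) B]) (use AB(1) K in \<open>simp_all add: abs_mult\<close>)
  ultimately show "V_bounded a b c p d \<longleftrightarrow> - a < (d - 1) / p \<and> (d - 1) / p < b - 1 \<and> c = a + b"
    unfolding V_bounded_def by simp
qed

end

theorem corollary3p8:
  fixes q :: nat
    and E :: "'v \<Rightarrow> 'v \<Rightarrow> bool"
    and ref :: 'v
    and \<omega> :: "(nat \<Rightarrow> 'v) set"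
    and a b c d p :: real
  assumes "homogeneous_flow_tree q E ref \<omega>"
    and "c > 1"
    and "p \<ge> 1"
  shows "(homogeneous_flow_tree.U_bounded q E \<omega> a b c p d \<longleftrightarrow>
          homogeneous_flow_tree.V_bounded q E \<omega> a b c p d)
       \<and> (homogeneous_flow_tree.V_bounded q E \<omega> a b c p d \<longleftrightarrow>
          - a < (d - 1) / p \<and> (d - 1) / p < b - 1 \<and> c = a + b)"
proof -
  interpret homogeneous_flow_tree q E ref \<omega> by (rule assms(1))
  show ?thesis using U_bounded_iff[OF assms(2,3)] V_bounded_iff[OF assms(2,3)] by blast
qed

end
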